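(* Let $A,C,G,W_1,W_2$ satisfy the standing assumptions (S1)-(S4) of the context, and let $\mathsf K\in\mathcal K_{\mathrm{info}}$. Then: (i) there is a continuous path lying in $\mathcal K_{\mathrm{info}}$ connecting $\mathsf K$ to some $\mathsf K_\star\in\mathcal K_{\mathrm{opt}}$; and (ii) if $\nabla\mathcal L_{\mathrm{OE}}(\mathsf K)=0$, then $\mathsf K\in\mathcal K_{\mathrm{opt}}$.
   Context: Output estimation (OE) problem. Let $n,m,p\ge 1$, $A\in\mathbb R^{n\times n}$, $C\in\mathbb R^{m\times n}$, $G\in\mathbb R^{p\times n}$, $W_1\in\mathbb R^{n\times n}$ and $W_2\in\mathbb R^{m\times m}$ symmetric. The true system is $\dot x(t)=Ax(t)+w(t)$, $y(t)=Cx(t)+v(t)$, $z(t)=Gx(t)$, $x(0)=0$, where $w,v$ are independent white Gaussian noises with intensities $W_1,W_2$. A filter is a triple $\mathsf K=(A_{\mathsf K},B_{\mathsf K},C_{\mathsf K})\in\mathbb R^{n\times n}\times\mathbb R^{n\times m}\times\mathbb R^{p\times n}$, with dynamics $\dot{\hat x}(t)=A_{\mathsf K}\hat x(t)+B_{\mathsf K}y(t)$, $\hat z(t)=C_{\mathsf K}\hat x(t)$. Its loss is $\mathcal L_{\mathrm{OE}}(\mathsf K)=\lim_{t\to\infty}\mathbb E\|z(t)-\hat z(t)\|^2$. $\mathcal K_{\mathrm{stab}}$ is the set of $\mathsf K$ with $A_{\mathsf K}$ Hurwitz stable (all eigenvalues have strictly negative real part). For $\mathsf K\in\mathcal K_{\mathrm{stab}}$,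 $\Sigma_{\mathsf K}\in\mathbb R^{2n\times 2n}$ is the stationary covariance of $(x,\hat x)$, i.e. the unique solution of $$A_{\mathrm{cl},\mathsf K}\Sigma+\Sigma A_{\mathrm{cl},\mathsf K}^\top+W_{\mathrm{cl},\mathsf K}=0,\quad A_{\mathrm{cl},\mathsf K}=\begin{bmatrix}A&0\\ B_{\mathsf K}C&A_{\mathsf K}\end{bmatrix},\quad W_{\mathrm{cl},\mathsf K}=\begin{bmatrix}W_1&0\\0&B_{\mathsf K}W_2B_{\mathsf K}^\top\end{bmatrix},$$ partitioned into $n\times n$ blocks $\Sigma_{\mathsf K}=\begin{bmatrix}\Sigma_{11,\mathrm{sys}}&\Sigma_{12,\mathsf K}\\ \Sigma_{12,\mathsf K}^\top&\Sigma_{22,\mathsf K}\end{bmatrix}$ (the first block does not depend on $\mathsf K$). Then $\mathcal L_{\mathrm{OE}}(\mathsf K)=\mathrm{tr}\big([G\ \ {-C_{\mathsf K}}]\,\Sigma_{\mathsf K}\,[G\ \ {-C_{\mathsf K}}]^\top\big)$. The informative filters are $\mathcal K_{\mathrm{info}}=\{\mathsf K\in\mathcal K_{\mathrm{stab}}:\mathrm{rank}(\Sigma_{12,\mathsf K})=n\}$. For invertible $S\in\mathbb R^{n\times n}$ let $\mathsf{Sim}_S(A_{\mathsf K},B_{\mathsf K},C_{\mathsf K})=(SA_{\mathsf K}S^{-1},SB_{\mathsf K},C_{\mathsf K}S^{-1})$. Let $P_\star$ be the (positive semidefinite, stabilizing) solution of the Riccati equation $AP_\star+P_\star A^\top-P_\star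 C^\top W_2^{-1}CP_\star+W_1=0$ and $L_\star=P_\star C^\top W_2^{-1}$. The set of optimal filters is $\mathcal K_{\mathrm{opt}}=\{\mathsf{Sim}_S(A-L_\star C,L_\star,G): S \text{ invertible}\}$. Standing assumptions: (S1) $A$ is Hurwitz stable. (S2) $(A,C)$ is observable, i.e. $\int_0^\infty e^{sA^\top}C^\top Ce^{sA}\,ds\succ0$. (S3) $W_1\succ0$ and $W_2\succ0$. (S4) For every $\mathsf K\in\mathcal K_{\mathrm{opt}}$, the pair $(A_{\mathsf K},B_{\mathsf K})$ is controllable.
   Formalization: Part (ii) fails as stated (e.g. scalar case with G=0). It is shown instead that a stationary K globally minimises the loss over stable filters, and lies in K_opt if controllability (S4) holds for every loss-minimising stable filter, not just the similarity orbit. *)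

theory Defs
  imports "HOL-Analysis.Analysis"
begin

section \<open>Matrix notions\<close>

text \<open>An n by m real matrix has type \<open>real^'m^'n\<close>.\<close>

definition hurwitz :: "real^'n^'n \<Rightarrow> bool" where
  "hurwitz M \<longleftrightarrow>
     (\<forall>(z::complex) (v::complex^'n).
        v \<noteq> 0 \<and> map_matrix complex_of_real M *v v = z *s v \<longrightarrow> Re z < 0)"

definition pos_semidef :: "real^'n^'n \<Rightarrow> bool" where
  "pos_semidef M \<longleftrightarrow> transpose M = M \<and> (\<forall>x. 0 \<le> x \<bullet> (M *v x))"

definition pos_def :: "real^'n^'n \<Rightarrow> bool" where
  "pos_def M \<longleftrightarrow> transpose M = M \<and> (\<forall>x. x \<noteq> 0 \<longrightarrow> 0 < x \<bullet> (M *v x))"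

text \<open>The library \<open>exp\<close> is not available here: \<open>real^'n^'n\<close> carries the componentwise product.\<close>

definition mat_exp :: "real^'n^'n \<Rightarrow> real^'n^'n" where
  "mat_exp M = (\<Sum>k. (1 / fact k) *\<^sub>R ((\<lambda>X. M ** X) ^^ k) (mat 1))"

text \<open>
  Observability and controllability are expressed by the infinite-horizon Gramians, which converge
  whenever the first argument is Hurwitz. These notions are only meant for such matrices; a
  divergent integral evaluates to \<open>0\<close>, which is not positive definite.
\<close>

definition observable :: "real^'n^'n \<Rightarrow> real^'n^'m \<Rightarrow> bool" where
  "observable A C \<longleftrightarrow>
     pos_def (integral {0..} (\<lambda>s. mat_exp (s *\<^sub>R transpose A) ** transpose C ** C ** mat_exp (s *\<^sub>R A)))"

definition controllable :: "real^'n^'n \<Rightarrow> real^'m^'n \<Rightarrow> bool" where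
  "controllable A B \<longleftrightarrow>
     pos_def (integral {0..} (\<lambda>s. mat_exp (s *\<^sub>R A) ** B ** transpose B ** mat_exp (s *\<^sub>R transpose A)))"

definition block_mat ::
  "'a^'n^'n \<Rightarrow> 'a^'m^'n \<Rightarrow> 'a^'n^'m \<Rightarrow> 'a^'m^'m \<Rightarrow> 'a^('n + 'm)^('n + 'm)" where
  "block_mat P Q R S =
     (\<chi> i j. case i of
        Inl a \<Rightarrow> (case j of Inl b \<Rightarrow> P $ a $ b | Inr b \<Rightarrow> Q $ a $ b)
      | Inr a \<Rightarrow> (case j of Inl b \<Rightarrow> R $ a $ b | Inr b \<Rightarrow> S $ a $ b))"

definition block_row :: "'a^'n^'p \<Rightarrow> 'a^'m^'p \<Rightarrow> 'a^('n + 'm)^'p" where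
  "block_row P Q = (\<chi> i j. case j of Inl b \<Rightarrow> P $ i $ b | Inr b \<Rightarrow> Q $ i $ b)"

definition upper_right :: "'a^('n + 'm)^('n + 'm) \<Rightarrow> 'a^'m^'n" where
  "upper_right M = (\<chi> i j. M $ Inl i $ Inr j)"


section \<open>Filters\<close>

text \<open>
  A filter is a triple \<open>(A\<^sub>K, B\<^sub>K, C\<^sub>K)\<close>. As a product of Euclidean spaces this type carries the
  Frobenius inner product, with respect to which gradients are taken.
\<close>

type_synonym ('n, 'm, 'p) filt = "(real^'n^'n) \<times> (real^'m^'n) \<times> (real^'n^'p)"

definition K_stab :: "('n::finite, 'm::finite, 'p::finite) filt set" where
  "K_stab = {(AK, BK, CK). hurwitz AK}"

fun A_cl :: "real^'n^'n \<Rightarrow> real^'n^'m \<Rightarrow> ('n, 'm, 'p::finite) filt \<Rightarrow> real^('n + 'n)^('n + 'n)" where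
  "A_cl A C (AK, BK, CK) = block_mat A 0 (BK ** C) AK"

fun W_cl :: "real^'n^'n \<Rightarrow> real^'m^'m \<Rightarrow> ('n, 'm, 'p::finite) filt \<Rightarrow> real^('n + 'n)^('n + 'n)" where
  "W_cl W1 W2 (AK, BK, CK) = block_mat W1 0 0 (BK ** W2 ** transpose BK)"

text \<open>The stationary covariance; the solution is unique when \<open>A\<close> and \<open>A\<^sub>K\<close> are Hurwitz.\<close>

definition Sigma_cl ::
  "real^'n^'n \<Rightarrow> real^'n^'m \<Rightarrow> real^'n^'n \<Rightarrow> real^'m^'m \<Rightarrow> ('n, 'm, 'p::finite) filt
    \<Rightarrow> real^('n + 'n)^('n + 'n)" where
  "Sigma_cl A C W1 W2 K =
     (THE \<Sigma>. A_cl A C K ** \<Sigma> + \<Sigma> ** transpose (A_cl A C K) + W_cl W1 W2 K = 0)"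

text \<open>
  The steady-state mean squared error of the output estimate: in the stationary regime
  \<open>z - z\<^sub>K = [G, -C\<^sub>K] (x, x\<^sub>K)\<close>, where \<open>(x, x\<^sub>K)\<close> is centred with covariance \<open>Sigma_cl\<close>.
  It has this meaning on \<open>K_stab\<close> only.
\<close>

definition L_OE ::
  "real^'n^'n \<Rightarrow> real^'n^'m \<Rightarrow> real^'n^'p \<Rightarrow> real^'n^'n \<Rightarrow> real^'m^'m
    \<Rightarrow> ('n, 'm, 'p::finite) filt \<Rightarrow> real" where
  "L_OE A C G W1 W2 K =
     (case K of (AK, BK, CK) \<Rightarrow>
        trace (block_row G (- CK) ** Sigma_cl A C W1 W2 K ** transpose (block_row G (- CK))))"

definition K_info ::
  "real^'n^'n \<Rightarrow> real^'n^'m \<Rightarrow> real^'n^'n \<Rightarrow> real^'m^'m \<Rightarrow> ('n, 'm, 'p::finite) filt set" where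
  "K_info A C W1 W2 =
     {K \<in> K_stab. rank (upper_right (Sigma_cl A C W1 W2 K)) = CARD('n)}"

fun Sim :: "real^'n^'n \<Rightarrow> ('n, 'm::finite, 'p::finite) filt \<Rightarrow> ('n, 'm, 'p) filt" where
  "Sim S (AK, BK, CK) = (S ** AK ** matrix_inv S, S ** BK, CK ** matrix_inv S)"


section \<open>Optimal filters\<close>

text \<open>Global minimisers of the loss over all stable filters.\<close>

definition optimal_filters ::
  "real^'n^'n \<Rightarrow> real^'n^'m \<Rightarrow> real^'n^'p \<Rightarrow> real^'n^'n \<Rightarrow> real^'m^'m
    \<Rightarrow> ('n, 'm, 'p::finite) filt set" where
  "optimal_filters A C G W1 W2 =
     {K \<in> K_stab. \<forall>K' \<in> K_stab. L_OE A C G W1 W2 K \<le> L_OE A C G W1 W2 K'}"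

definition stabilizing_riccati_solution ::
  "real^'n^'n \<Rightarrow> real^'n^'m \<Rightarrow> real^'n^'n \<Rightarrow> real^'m^'m \<Rightarrow> real^'n^'n \<Rightarrow> bool" where
  "stabilizing_riccati_solution A C W1 W2 P \<longleftrightarrow>
     pos_semidef P \<and>
     A ** P + P ** transpose A - P ** transpose C ** matrix_inv W2 ** C ** P + W1 = 0 \<and>
     hurwitz (A - P ** transpose C ** matrix_inv W2 ** C)"

definition P_star ::
  "real^'n^'n \<Rightarrow> real^'n^'m \<Rightarrow> real^'n^'n \<Rightarrow> real^'m^'m \<Rightarrow> real^'n^'n" where
  "P_star A C W1 W2 = (THE P. stabilizing_riccati_solution A C W1 W2 P)"

definition L_star ::
  "real^'n^'n \<Rightarrow> real^'n^'m \<Rightarrow> real^'n^'n \<Rightarrow> real^'m^'m \<Rightarrow> real^'m^'n" where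
  "L_star A C W1 W2 = P_star A C W1 W2 ** transpose C ** matrix_inv W2"

text \<open>
  The similarity orbit of the Kalman filter. It consists of optimal filters, but it exhausts them
  only if the Kalman filter is a minimal realization. For \<open>G = 0\<close>, every stable filter with
  \<open>C\<^sub>K = 0\<close> is optimal, and a stationary point of the loss, whatever \<open>A\<^sub>K\<close> and \<open>B\<^sub>K\<close> are.
\<close>

definition K_opt ::
  "real^'n^'n \<Rightarrow> real^'n^'m \<Rightarrow> real^'n^'p \<Rightarrow> real^'n^'n \<Rightarrow> real^'m^'m
    \<Rightarrow> ('n, 'm, 'p::finite) filt set" where
  "K_opt A C G W1 W2 =
     {Sim S (A - L_star A C W1 W2 ** C, L_star A C W1 W2, G) | S. invertible S}"

end

(*
  Write X, R, Y for the blocks of the stationary covariance.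

  Path: if R is kept constant, the Sylvester equation for R turns A_K into F - B H with F, H fixed, so
  that informative filters with a given R correspond to stabilizing gains B (and arbitrary C_K).
  Multiplying by a Lyapunov certificate Q makes this set convex in (Q, Q B). The Kalman filter can be
  given the same R by a similarity transformation, because controllability makes X - P_star
  invertible.

  Stationary points: choose coordinates in which R = Y = Z and put P = X - Z. Vanishing of the gradient
  gives C_K = G and, varying B with R held constant, \<Lambda> D = 0, where \<Lambda> is the observability
  Gramian of (A_K, G) and D = B W2 - P C^T. Subtracting Riccati equations gives
  A_K E + E (A - L_star C)^T = D N with E = P - P_star, hence E G^T = 0 by comparing spectra on the
  observable part, and the loss attains the lower bound tr (G P_star G^T). If \<Lambda> is invertible, then
  D = 0 and the filter is the Kalman filter; otherwise removing the unobservable part of the filter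
  yields an optimal filter that is not controllable.
*)

theory Submission
  imports Defs "HOL-Computational_Algebra.Fundamental_Theorem_Algebra"
begin

declare transpose_matrix_vector [simp del] vector_transpose_matrix [simp del]

notation transpose (\<open>_\<^sup>T\<close> [1000] 999)

section \<open>Matrix algebra\<close>

interpretation matmul: bounded_bilinear "(**) :: real^'n^'m \<Rightarrow> real^'p^'n \<Rightarrow> real^'p^'m"
  unfolding bilinear_conv_bounded_bilinear [symmetric] bilinear_def
  by (auto intro!: linearI simp: vec_eq_iff matrix_matrix_mult_def algebra_simps sum.distrib
      sum_distrib_left)

lemma transpose_zero [simp]: "(0 :: 'a::zero^'n^'m)\<^sup>T = 0"
  and transpose_add: "(M + N)\<^sup>T = M\<^sup>T + (N\<^sup>T :: 'b::plus^'n^'m)"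
  and transpose_diff: "(P - Q)\<^sup>T = P\<^sup>T - (Q\<^sup>T :: 'c::minus^'n^'m)"
  and transpose_uminus: "(- U)\<^sup>T = - (U\<^sup>T :: 'd::uminus^'n^'m)"
  by (simp_all add: transpose_def vec_eq_iff)

lemma matrix_vector_uminus: "(- M) *v x = - (M *v (x :: real^'n))"
  by (simp add: matrix_vector_mult_def vec_eq_iff sum_negf)

lemmas transpose_simps =
  transpose_add transpose_diff transpose_uminus transpose_scalar matrix_transpose_mul

lemmas mat_ring =
  matmul.add_left matmul.add_right matmul.diff_left matmul.diff_right
  matmul.minus_left matmul.minus_right matmul.scaleR_left matmul.scaleR_right
  matmul.zero_left matmul.zero_right matrix_mul_assoc transpose_simps

lemma inner_transpose: "x \<bullet> (M *v y) = (M\<^sup>T *v x) \<bullet> (y :: real^'n)"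
  by (simp add: transpose_matrix_vector dot_lmul_matrix)

lemma matrix_eq_0_iff: "M = 0 \<longleftrightarrow> (\<forall>v. M *v v = (0 :: real^'m))"
  by (metis matrix_eq matrix_vector_mult_0)

section \<open>Hurwitz matrices and Sylvester equations\<close>

definition cvec :: "real^'n \<Rightarrow> real^'n \<Rightarrow> complex^'n" where
  "cvec a b = (\<chi> i. Complex (a $ i) (b $ i))"

abbreviation cmat :: "real^'n^'m \<Rightarrow> complex^'n^'m" where
  "cmat \<equiv> map_matrix complex_of_real"

lemma cmat_cvec: "cmat M *v cvec a b = cvec (M *v a) (M *v b)"
  by (simp add: vec_eq_iff matrix_vector_mult_def cvec_def complex_eq_iff)

lemma scale_cvec: "z *s cvec a b = cvec (Re z *\<^sub>R a - Im z *\<^sub>R b) (Im z *\<^sub>R a + Re z *\<^sub>R b)"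
  by (simp add: vec_eq_iff cvec_def complex_eq_iff)

lemma cvec_eq_iff: "cvec a b = cvec c d \<longleftrightarrow> a = c \<and> b = d"
  by (auto simp: vec_eq_iff cvec_def)

lemma cvec_eq_0_iff: "cvec a b = 0 \<longleftrightarrow> a = 0 \<and> b = 0"
  by (auto simp: vec_eq_iff cvec_def complex_eq_iff)

lemma cvec_surj: "\<exists>a b. v = cvec a b"
  by (rule exI[of _ "\<chi> i. Re (v $ i)"], rule exI[of _ "\<chi> i. Im (v $ i)"])
    (simp add: cvec_def vec_eq_iff)

lemma hurwitz_iff_real:
  "hurwitz M \<longleftrightarrow>
     (\<forall>s w a b. (a \<noteq> 0 \<or> b \<noteq> 0) \<and> M *v a = s *\<^sub>R a - w *\<^sub>R b \<and> M *v b = w *\<^sub>R a + s *\<^sub>R b \<longrightarrow> s < 0)"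
proof
  assume H: "hurwitz M"
  show "\<forall>s w a b. (a \<noteq> 0 \<or> b \<noteq> 0) \<and> M *v a = s *\<^sub>R a - w *\<^sub>R b \<and> M *v b = w *\<^sub>R a + s *\<^sub>R b \<longrightarrow> s < 0"
  proof (intro allI impI)
    fix s w a b
    assume "(a \<noteq> 0 \<or> b \<noteq> 0) \<and> M *v a = s *\<^sub>R a - w *\<^sub>R b \<and> M *v b = w *\<^sub>R a + s *\<^sub>R b"
    then have "cvec a b \<noteq> 0" "cmat M *v cvec a b = Complex s w *s cvec a b"
      by (auto simp: cvec_eq_0_iff cmat_cvec scale_cvec cvec_eq_iff)
    then show "s < 0"
      using H unfolding hurwitz_def by (metis complex.sel(1))
  qed
next
  assume R: "\<forall>s w a b. (a \<noteq> 0 \<or> b \<noteq> 0) \<and> M *v a = s *\<^sub>R a - w *\<^sub>R b \<and> M *v b = w *\<^sub>R a + s *\<^sub>R b \<longrightarrow> s < 0"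
  show "hurwitz M"
    unfolding hurwitz_def
  proof (intro allI impI)
    fix z and v :: "complex^'a"
    assume v: "v \<noteq> 0 \<and> cmat M *v v = z *s v"
    obtain a b where "v = cvec a b"
      using cvec_surj by blast
    with v R show "Re z < 0"
      by (auto simp: cvec_eq_0_iff cmat_cvec scale_cvec cvec_eq_iff)
  qed
qed

lemma eigenvalue_transpose:
  fixes M :: "complex^'n^'n"
  assumes "v \<noteq> 0" "M\<^sup>T *v v = z *s v"
  shows "\<exists>w. w \<noteq> 0 \<and> M *v w = z *s w"
proof (rule ccontr)
  assume no: "\<not> ?thesis"
  have shift: "(N - mat z) *v x = N *v x - z *s x" for N :: "complex^'n^'n" and x
  proof -
    have "mat z *v x = z *s x"
      by (simp add: vec_eq_iff matrix_vector_mult_def mat_def if_distrib if_distribR cong: if_cong)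
    then show ?thesis
      by (simp add: matrix_vector_mult_diff_rdistrib)
  qed
  have "\<forall>x. (M - mat z) *v x = 0 \<longrightarrow> x = 0"
    using no by (auto simp: shift)
  then have "\<exists>B. B ** (M - mat z) = mat 1"
    unfolding matrix_left_invertible_ker .
  then have "\<exists>B. (M - mat z) ** B = mat 1"
    using matrix_left_right_inverse by blast
  then have "\<exists>B. B ** (M - mat z)\<^sup>T = mat 1"
    unfolding left_invertible_transpose .
  then have "\<forall>x. (M - mat z)\<^sup>T *v x = 0 \<longrightarrow> x = 0"
    unfolding matrix_left_invertible_ker .
  then show False
    using assms by (auto simp: transpose_diff shift)
qed

lemma hurwitz_transpose_imp:
  assumes "hurwitz M" shows "hurwitz (M\<^sup>T)"
proof -
  have "cmat (M\<^sup>T) = (cmat M)\<^sup>T"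
    by (simp add: vec_eq_iff transpose_def)
  then show ?thesis
    using assms eigenvalue_transpose[of _ "cmat M"] unfolding hurwitz_def by metis
qed

lemma hurwitz_transpose [simp]: "hurwitz (M\<^sup>T) \<longleftrightarrow> hurwitz M"
  using hurwitz_transpose_imp[of M] hurwitz_transpose_imp[of "M\<^sup>T"] by auto

definition poly_app :: "complex^'n^'n \<Rightarrow> complex poly \<Rightarrow> complex^'n \<Rightarrow> complex^'n" where
  "poly_app M p v = fold_coeffs (\<lambda>a u. a *s v + M *v u) p 0"

lemma poly_app_0 [simp]: "poly_app M 0 v = 0"
  by (simp add: poly_app_def)

lemma poly_app_pCons [simp]: "poly_app M (pCons a p) v = a *s v + M *v poly_app M p v"
proof (cases "p = 0 \<and> a = 0")
  case True
  then show ?thesis by simp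
next
  case False
  then show ?thesis
    by (cases "a = 0") (auto simp: poly_app_def)
qed

lemma matrix_vector_scale: "M *v (c *s v) = c *s (M *v (v :: complex^'n))"
  by (simp add: vec_eq_iff matrix_vector_mult_def sum_distrib_left algebra_simps)

lemma poly_app_add: "poly_app M (p + q) v = poly_app M p v + poly_app M q v"
  by (induction p q rule: poly_induct2) (auto simp: algebra_simps vec.scale_left_distrib)

lemma poly_app_smult: "poly_app M (smult c p) v = c *s poly_app M p v"
  by (induction p) (auto simp: matrix_vector_scale vec.scale_right_distrib)

lemma poly_app_monom: "poly_app M (monom a i) v = a *s (((*v) M ^^ i) v)"
  by (induction i) (auto simp: monom_0 monom_Suc matrix_vector_scale)

lemma poly_app_sum: "poly_app M (\<Sum>i\<in>I. f i) v = (\<Sum>i\<in>I. poly_app M (f i) v)"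
  by (induction I rule: infinite_finite_induct) (auto simp: poly_app_add)

lemma poly_app_linear_factor:
  "poly_app M ([:- r, 1:] * q) v = M *v poly_app M q v - r *s poly_app M q v"
proof -
  have "[:- r, 1:] * q = smult (- r) q + pCons 0 q"
    by simp
  then show ?thesis
    by (simp only: poly_app_add poly_app_smult poly_app_pCons) (simp add: vec.scale_minus_left)
qed

lemma poly_app_commute: "poly_app M p (M *v v) = M *v poly_app M p v"
  by (induction p) (auto simp: matrix_vector_scale algebra_simps)

lemma poly_app_intertwine:
  assumes "\<And>j. T *v (((*v) M ^^ j) v) = ((*v) N ^^ j) (T *v v)"
  shows "T *v poly_app M p v = poly_app N p (T *v v)"
  using assms
proof (induction p arbitrary: v)
  case 0
  then show ?case by simp
next
  case (pCons a p)
  have Tv: "T *v (M *v v) = N *v (T *v v)"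
    using pCons.prems[of 1] by simp
  have "T *v poly_app M p (M *v v) = poly_app N p (T *v (M *v v))"
  proof (rule pCons.IH)
    show "T *v ((*v) M ^^ j) (M *v v) = ((*v) N ^^ j) (T *v (M *v v))" for j
      using pCons.prems[of "Suc j"] unfolding Tv by (simp add: funpow_swap1)
  qed
  then show ?case
    by (simp add: poly_app_commute [symmetric] Tv matrix_vector_scale algebra_simps)
qed

lemma annihilating_poly_exists:
  fixes M :: "complex^'n^'n"
  shows "\<exists>p. p \<noteq> 0 \<and> poly_app M p v = 0"
proof -
  define f where "f i = ((*v) M ^^ i) v" for i
  let ?I = "{..DIM(complex^'n)}"
  show ?thesis
  proof (cases "inj_on f ?I")
    case False
    then obtain i j where ij: "i \<noteq> j" "f i = f j"
      by (auto simp: inj_on_def)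
    let ?p = "monom 1 i + monom (-1) j :: complex poly"
    have "coeff ?p i = 1"
      using ij by simp
    then have "?p \<noteq> 0"
      by (metis coeff_0 zero_neq_one)
    moreover have "poly_app M ?p v = 0"
      using ij unfolding poly_app_add poly_app_monom f_def by simp
    ultimately show ?thesis by blast
  next
    case True
    have "dependent (f ` ?I)"
      using card_image[OF True] by (intro dependent_biggerset) simp_all
    then obtain u where u: "\<exists>x\<in>f ` ?I. u x \<noteq> 0" "(\<Sum>x\<in>f ` ?I. u x *\<^sub>R x) = 0"
      using dependent_finite[of "f ` ?I"] by auto
    let ?p = "\<Sum>i\<in>?I. monom (complex_of_real (u (f i))) i"
    from u(1) obtain k where k: "k \<in> ?I" "u (f k) \<noteq> 0"
      by blast
    have "coeff ?p k = complex_of_real (u (f k))"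
      using k(1) by (simp add: coeff_sum if_distrib cong: if_cong)
    with k have "?p \<noteq> 0"
      by (metis coeff_0 of_real_eq_0_iff)
    moreover have "poly_app M ?p v = (\<Sum>i\<in>?I. u (f i) *\<^sub>R f i)"
    proof -
      have "complex_of_real c *s w = c *\<^sub>R w" for c and w :: "complex^'n"
        by (simp add: vec_eq_iff scaleR_conv_of_real[where 'a = complex])
      then show ?thesis
        unfolding poly_app_sum poly_app_monom f_def by simp
    qed
    ultimately show ?thesis
      using u(2) by (metis (no_types, lifting) True sum.reindex_cong)
  qed
qed

lemma poly_app_eigenvalue:
  assumes "p \<noteq> 0" "poly_app M p u = 0" "u \<noteq> 0"
  shows "\<exists>r w. poly p r = 0 \<and> w \<noteq> 0 \<and> M *v w = r *s w"
  using assms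
proof (induction "degree p" arbitrary: p rule: less_induct)
  case less
  have "degree p \<noteq> 0"
  proof
    assume "degree p = 0"
    then obtain c where "p = [:c:]"
      by (metis degree_eq_zeroE)
    with less.prems show False
      by simp
  qed
  then obtain r where r: "poly p r = 0"
    using fundamental_theorem_of_algebra constant_degree by metis
  then obtain q where q: "p = [:- r, 1:] * q"
    using poly_eq_0_iff_dvd dvdE by metis
  with less.prems(1) have "q \<noteq> 0"
    by auto
  then have "degree q < degree p"
    unfolding q by (subst degree_mult_eq) auto
  show ?case
  proof (cases "poly_app M q u = 0")
    case True
    then show ?thesis
      using less.hyps[OF \<open>degree q < degree p\<close> \<open>q \<noteq> 0\<close> True less.prems(3)] q by auto
  next
    case False
    then show ?thesis
      using less.prems(2) r unfolding q poly_app_linear_factor by auto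
  qed
qed

text \<open>Roots of the minimal polynomial of \<open>v\<close> are eigenvalues of \<open>M\<close>.\<close>

lemma hurwitz_annihilating_poly:
  assumes "hurwitz M"
  shows "\<exists>p. p \<noteq> 0 \<and> poly_app (cmat M) p v = 0 \<and> (\<forall>r. poly p r = 0 \<longrightarrow> Re r < 0)"
proof -
  let ?P = "\<lambda>p. p \<noteq> 0 \<and> poly_app (cmat M) p v = 0"
  obtain p where p: "?P p" and least: "\<And>q. ?P q \<Longrightarrow> degree p \<le> degree q"
    using annihilating_poly_exists[of "cmat M" v] ex_has_least_nat[of ?P _ degree] by metis
  have "Re r < 0" if r: "poly p r = 0" for r
  proof -
    obtain q where q: "p = [:- r, 1:] * q"
      using r poly_eq_0_iff_dvd dvdE by metis
    with p have "q \<noteq> 0"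
      by auto
    then have "degree q < degree p"
      unfolding q by (subst degree_mult_eq) auto
    with least \<open>q \<noteq> 0\<close> have "poly_app (cmat M) q v \<noteq> 0"
      using not_less by blast
    moreover have "cmat M *v poly_app (cmat M) q v = r *s poly_app (cmat M) q v"
      using p unfolding q poly_app_linear_factor by auto
    ultimately show ?thesis
      using assms unfolding hurwitz_def by blast
  qed
  with p show ?thesis by blast
qed

lemma hurwitz_intertwine:
  fixes M :: "real^'n^'n" and N :: "real^'k^'k" and T :: "real^'n^'k"
  assumes M: "hurwitz M" and N: "hurwitz N"
    and T: "\<And>j. T *v (((*v) M ^^ j) v) = ((*v) (- N) ^^ j) (T *v v)"
  shows "T *v v = 0"
proof (rule ccontr)
  assume nz: "T *v v \<noteq> 0"
  have pow: "((*v) (cmat Q) ^^ j) (cvec x 0) = cvec (((*v) Q ^^ j) x) 0" for Q :: "real^'m^'m" and j x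
    by (induction j) (auto simp: cmat_cvec)
  obtain p where p: "p \<noteq> 0" "poly_app (cmat M) p (cvec v 0) = 0"
    and roots: "\<And>r. poly p r = 0 \<Longrightarrow> Re r < 0"
    using hurwitz_annihilating_poly[OF M] by metis
  have "cmat T *v poly_app (cmat M) p (cvec v 0) = poly_app (cmat (- N)) p (cmat T *v cvec v 0)"
    by (rule poly_app_intertwine) (simp add: pow cmat_cvec T)
  then have "poly_app (cmat (- N)) p (cvec (T *v v) 0) = 0"
    by (simp add: p cmat_cvec)
  moreover have "cvec (T *v v) 0 \<noteq> 0"
    using nz by (simp add: cvec_eq_0_iff)
  ultimately obtain r w where r: "poly p r = 0" and w: "w \<noteq> 0" "cmat (- N) *v w = r *s w"
    using poly_app_eigenvalue p(1) by blast
  have "cmat N *v w = - (cmat (- N) *v w)"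
    by (simp add: vec_eq_iff matrix_vector_mult_def sum_negf)
  also have "\<dots> = (- r) *s w"
    by (simp add: w vec.scale_minus_left)
  finally have "Re (- r) < 0"
    using N w(1) unfolding hurwitz_def by blast
  with roots[OF r] show False
    by simp
qed

lemma sylvester_unique:
  assumes "hurwitz M" "hurwitz N" "M ** X + X ** N\<^sup>T = 0"
  shows "X = 0"
proof -
  have X: "X *v (N\<^sup>T *v v) = (- M) *v (X *v v)" for v
  proof -
    have "X ** N\<^sup>T = (- M) ** X"
      using assms(3) by (simp add: matmul.minus_left eq_neg_iff_add_eq_0 add.commute)
    then show ?thesis
      by (simp only: matrix_vector_mul_assoc)
  qed
  have "X *v v = 0" for v
  proof (rule hurwitz_intertwine)
    show "hurwitz (N\<^sup>T)" "hurwitz M"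
      using assms by auto
    show "X *v ((*v) (N\<^sup>T) ^^ j) v = ((*v) (- M) ^^ j) (X *v v)" for j
      by (induction j) (auto simp: X)
  qed
  then show ?thesis
    by (simp add: matrix_eq_0_iff)
qed

section \<open>Positive semidefinite matrices and Lyapunov equations\<close>

lemma matrix_inv_right: "invertible M \<Longrightarrow> M ** matrix_inv M = mat 1"
  and matrix_inv_left: "invertible M \<Longrightarrow> matrix_inv M ** M = mat 1"
  unfolding invertible_def matrix_inv_def by (metis (mono_tags, lifting) someI_ex)+

lemma invertible_iff_ker: "invertible (M :: real^'n^'n) \<longleftrightarrow> (\<forall>x. M *v x = 0 \<longrightarrow> x = 0)"
  unfolding invertible_left_inverse matrix_left_invertible_ker ..

lemma invertible_matrix_inv: "invertible M \<Longrightarrow> invertible (matrix_inv M)"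
  unfolding invertible_def using matrix_inv_left matrix_inv_right invertible_def by blast

lemma pos_def_imp_semidef: "pos_def M \<Longrightarrow> pos_semidef M"
  unfolding pos_def_def pos_semidef_def by (metis inner_zero_left less_eq_real_def)

lemma pos_def_mat_1: "pos_def (mat 1)"
  by (simp add: pos_def_def)

lemma pos_def_invertible: "pos_def M \<Longrightarrow> invertible M"
  unfolding invertible_iff_ker pos_def_def by (metis inner_zero_right less_irrefl)

lemma pos_def_add: "pos_def M \<Longrightarrow> pos_semidef N \<Longrightarrow> pos_def (M + N)"
  by (simp add: pos_def_def pos_semidef_def transpose_add matrix_vector_mult_add_rdistrib
      inner_add_right add_pos_nonneg)

lemma pos_def_scaleR: "pos_def M \<Longrightarrow> 0 < c \<Longrightarrow> pos_def (c *\<^sub>R M)"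
  by (simp add: pos_def_def transpose_scalar scaleR_matrix_vector_assoc [symmetric])

lemma pos_semidef_scaleR: "pos_semidef M \<Longrightarrow> 0 \<le> c \<Longrightarrow> pos_semidef (c *\<^sub>R M)"
  by (simp add: pos_semidef_def transpose_scalar scaleR_matrix_vector_assoc [symmetric])

lemma inner_congruence: "x \<bullet> ((K ** W ** K\<^sup>T) *v x) = (K\<^sup>T *v x) \<bullet> (W *v (K\<^sup>T *v x))"
  for K :: "real^'m^'n"
  by (simp add: matrix_vector_mul_assoc [symmetric] inner_transpose)

lemma pos_semidef_congruence:
  fixes K :: "real^'m^'n"
  shows "pos_semidef W \<Longrightarrow> pos_semidef (K ** W ** K\<^sup>T)"
  unfolding pos_semidef_def inner_congruence by (simp add: mat_ring)

lemma pos_def_inverse: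
  assumes "pos_def W"
  shows "pos_def (matrix_inv W)"
proof -
  let ?V = "matrix_inv W"
  have inv: "W ** ?V = mat 1" "?V ** W = mat 1"
    using assms pos_def_invertible matrix_inv_left matrix_inv_right by auto
  have sym: "W\<^sup>T = W"
    using assms by (simp add: pos_def_def)
  have "?V\<^sup>T = ?V\<^sup>T ** (W ** ?V)"
    by (simp add: inv)
  also have "\<dots> = (W ** ?V)\<^sup>T ** ?V"
    by (simp add: matrix_mul_assoc matrix_transpose_mul sym)
  finally have symV: "?V\<^sup>T = ?V"
    by (simp add: inv)
  have eq: "?V = ?V ** W ** ?V\<^sup>T"
    by (simp add: inv symV)
  have "0 < x \<bullet> (?V *v x)" if "x \<noteq> 0" for x
  proof -
    have "?V *v x \<noteq> 0"
      using that inv(1) by (metis matrix_vector_mul_assoc matrix_vector_mul_lid matrix_vector_mult_0_right)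
    then have "0 < (?V *v x) \<bullet> (W *v (?V *v x))"
      using assms by (simp add: pos_def_def)
    also have "\<dots> = x \<bullet> (?V *v x)"
      by (metis inner_congruence eq symV)
    finally show ?thesis .
  qed
  then show ?thesis
    using symV by (simp add: pos_def_def)
qed

lemma pos_semidef_null:
  assumes "pos_semidef X" "x \<bullet> (X *v x) = 0"
  shows "X *v x = 0"
proof (rule ccontr)
  assume "X *v x \<noteq> 0"
  let ?y = "X *v x"
  let ?a = "?y \<bullet> ?y" and ?b = "?y \<bullet> (X *v ?y)"
  have a: "0 < ?a"
    using \<open>X *v x \<noteq> 0\<close> by simp
  have b: "0 \<le> ?b"
    using assms(1) by (simp add: pos_semidef_def)
  define s where "s = ?a / (?b + 1)"
  have s: "0 < s"
    using a b by (simp add: s_def)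
  have "x \<bullet> (X *v ?y) = ?a"
    using assms(1) by (subst inner_transpose) (simp add: pos_semidef_def)
  moreover have "0 \<le> (x - s *\<^sub>R ?y) \<bullet> (X *v (x - s *\<^sub>R ?y))"
    using assms(1) by (simp add: pos_semidef_def)
  ultimately have "0 \<le> s * (s * ?b - 2 * ?a)"
    using assms(2)
    by (simp add: matrix_vector_mult_diff_distrib matrix_vector_mult_scaleR inner_diff_left
        inner_diff_right algebra_simps)
  then have "2 * ?a \<le> s * ?b"
    using s by (simp add: zero_le_mult_iff)
  also have "s * ?b \<le> ?a"
    using a b by (simp add: s_def field_simps)
  finally show False
    using a by simp
qed

lemma pos_semidef_ker:
  "pos_semidef M \<Longrightarrow> invertible M \<Longrightarrow> pos_def M"
  unfolding pos_def_def invertible_iff_ker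
  by (metis pos_semidef_def pos_semidef_null less_eq_real_def)

lemma trace_mul_transpose: "trace (M ** N\<^sup>T) = M \<bullet> (N :: real^'n^'m)"
  by (simp add: trace_def matrix_matrix_mult_def transpose_def inner_vec_def)

lemma trace_transpose: "trace (M\<^sup>T) = trace M"
  by (simp add: trace_def transpose_def)

lemma trace_scaleR: "trace (c *\<^sub>R M) = c * trace (M :: real^'n^'n)"
  by (simp add: trace_def sum_distrib_left)

lemma trace_uminus: "trace (- M) = - trace (M :: real^'n^'n)"
  by (simp add: trace_def sum_negf)

lemma bounded_linear_trace: "bounded_linear (trace :: real^'n^'n \<Rightarrow> real)"
  by (intro linear_conv_bounded_linear[THEN iffD1] linearI) (simp_all add: trace_add trace_scaleR)

lemma axis_inner_matrix: "axis i 1 \<bullet> (M *v axis j 1) = (M :: real^'n^'n) $ i $ j"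
  by (simp add: inner_axis' matrix_vector_mult_basis column_def)

lemma pos_semidef_diag: "pos_semidef M \<Longrightarrow> 0 \<le> M $ i $ i"
  unfolding pos_semidef_def axis_inner_matrix [symmetric] by blast

lemma pos_semidef_trace: "pos_semidef M \<Longrightarrow> 0 \<le> trace M"
  unfolding trace_def by (simp add: sum_nonneg pos_semidef_diag)

lemma pos_semidef_entry_le_trace:
  assumes "pos_semidef M"
  shows "\<bar>M $ i $ j\<bar> \<le> trace M"
proof -
  have sym: "M $ j $ i = M $ i $ j"
  proof -
    have "M\<^sup>T $ i $ j = M $ i $ j"
      using assms by (simp add: pos_semidef_def)
    then show ?thesis
      by (simp add: transpose_def)
  qed
  have "0 \<le> (axis i 1 + c *\<^sub>R axis j 1) \<bullet> (M *v (axis i 1 + c *\<^sub>R axis j 1))" for c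
    using assms by (simp add: pos_semidef_def)
  then have *: "0 \<le> M $ i $ i + c * (M $ i $ j + M $ i $ j) + c * c * M $ j $ j" for c
    by (simp add: matrix_vector_right_distrib matrix_vector_mult_scaleR inner_add_left
        inner_add_right axis_inner_matrix sym algebra_simps)
  have diag: "M $ k $ k \<le> trace M" for k
    unfolding trace_def using assms by (intro member_le_sum) (auto simp: pos_semidef_diag)
  show ?thesis
    using *[of 1] *[of "-1"] diag[of i] diag[of j] by simp
qed

lemma pos_semidef_trace_0: "pos_semidef M \<Longrightarrow> trace M = 0 \<Longrightarrow> M = 0"
  using pos_semidef_entry_le_trace[of M] by (simp add: vec_eq_iff)

lemma hurwitz_certificate:
  assumes X: "pos_semidef X" and Q: "pos_def Q" and eq: "M ** X + X ** M\<^sup>T + Q = 0"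
  shows "hurwitz M"
proof -
  have quad: "2 * ((M\<^sup>T *v x) \<bullet> (X *v x)) = - (x \<bullet> (Q *v x))" for x
  proof -
    have "x \<bullet> ((X ** M\<^sup>T) *v x) = (X *v x) \<bullet> (M\<^sup>T *v x)"
      using X by (simp add: matrix_vector_mul_assoc [symmetric] inner_transpose[of _ X] pos_semidef_def)
    moreover have "x \<bullet> ((M ** X) *v x) = (M\<^sup>T *v x) \<bullet> (X *v x)"
      by (simp add: matrix_vector_mul_assoc [symmetric] inner_transpose)
    moreover have "x \<bullet> ((M ** X + X ** M\<^sup>T + Q) *v x) = 0"
      by (simp add: eq)
    ultimately show ?thesis
      by (simp add: matrix_vector_mult_add_rdistrib inner_add_right inner_commute)
  qed
  have "hurwitz (M\<^sup>T)"
    unfolding hurwitz_iff_real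
  proof (intro allI impI)
    fix s w a b
    assume ab: "(a \<noteq> 0 \<or> b \<noteq> 0) \<and> M\<^sup>T *v a = s *\<^sub>R a - w *\<^sub>R b \<and> M\<^sup>T *v b = w *\<^sub>R a + s *\<^sub>R b"
    have sym: "b \<bullet> (X *v a) = a \<bullet> (X *v b)"
      using X inner_transpose[of b X a] by (simp add: pos_semidef_def inner_commute)
    have nonneg: "0 \<le> a \<bullet> (Q *v a)" "0 \<le> b \<bullet> (Q *v b)" "0 \<le> a \<bullet> (X *v a)" "0 \<le> b \<bullet> (X *v b)"
      using X pos_def_imp_semidef[OF Q] by (auto simp: pos_semidef_def)
    have "0 < a \<bullet> (Q *v a) + b \<bullet> (Q *v b)"
      using ab Q nonneg unfolding pos_def_def by (metis add_nonneg_pos add_pos_nonneg)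
    moreover have "2 * (s * (a \<bullet> (X *v a) + b \<bullet> (X *v b))) = - (a \<bullet> (Q *v a) + b \<bullet> (Q *v b))"
      using quad[of a] quad[of b] ab
      by (simp add: inner_diff_left inner_add_left sym algebra_simps)
    ultimately have "s * (a \<bullet> (X *v a) + b \<bullet> (X *v b)) < 0"
      by linarith
    with nonneg show "s < 0"
      by (metis add_nonneg_nonneg mult_nonneg_nonneg not_less)
  qed
  then show ?thesis by simp
qed

lemma affine_family_continuous:
  fixes U V :: "'a::euclidean_space \<Rightarrow> 'a" and S :: "real set"
  assumes "linear U" "linear V" and inj: "\<And>t. t \<in> S \<Longrightarrow> inj (\<lambda>x. U x + t *\<^sub>R V x)"
    and eq: "\<And>t. t \<in> S \<Longrightarrow> U (x t) + t *\<^sub>R V (x t) = q t"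
    and q: "continuous_on S q"
  shows "continuous_on S x"
  unfolding continuous_on_def
proof
  fix r assume r: "r \<in> S"
  have lin: "linear (\<lambda>x. U x + r *\<^sub>R V x)"
    using assms(1,2) by (intro linear_compose_add linear_compose_scale_right)
  obtain c where c: "0 < c" "\<And>y. c * norm y \<le> norm (U y + r *\<^sub>R V y)"
    using linear_inj_bounded_below_pos[OF lin inj[OF r]] by blast
  obtain k where k: "0 < k" "\<And>y. norm (V y) \<le> k * norm y"
    using linear_bounded_pos[OF assms(2)] by blast
  have bound: "(c - \<bar>t - r\<bar> * k) * norm (x t - x r) \<le> norm (q t - q r) + \<bar>t - r\<bar> * k * norm (x r)"
    if "t \<in> S" for t
  proof -
    have "U (x t - x r) + r *\<^sub>R V (x t - x r) = (q t - q r) - (t - r) *\<^sub>R V (x t)"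
      using eq[OF that, symmetric] eq[OF r, symmetric] assms(1,2)
      by (simp add: linear_diff algebra_simps)
    then have "c * norm (x t - x r) \<le> norm (q t - q r) + \<bar>t - r\<bar> * norm (V (x t))"
      using c(2)[of "x t - x r"] norm_triangle_ineq4[of "q t - q r" "(t - r) *\<^sub>R V (x t)"] by simp
    moreover have "norm (V (x t)) \<le> k * (norm (x t - x r) + norm (x r))"
    proof -
      have "norm (x t) \<le> norm (x t - x r) + norm (x r)"
        using norm_triangle_sub[of "x t" "x r"] by simp
      then show ?thesis
        using k by (meson order_trans mult_left_mono less_imp_le)
    qed
    ultimately have "c * norm (x t - x r)
        \<le> norm (q t - q r) + \<bar>t - r\<bar> * (k * (norm (x t - x r) + norm (x r)))"
      by (meson abs_ge_zero add_left_mono mult_left_mono order_trans)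
    then show ?thesis
      by (simp add: algebra_simps)
  qed
  have qlim: "((\<lambda>t. norm (q t - q r)) \<longlongrightarrow> 0) (at r within S)"
    using q r unfolding continuous_on_def by (metis LIM_zero_iff tendsto_norm_zero)
  have lim_t: "((\<lambda>t. \<bar>t - r\<bar>) \<longlongrightarrow> 0) (at r within S)"
    by (auto intro!: tendsto_eq_intros)
  have den: "((\<lambda>t. c - \<bar>t - r\<bar> * k) \<longlongrightarrow> c) (at r within S)"
    by (auto intro!: tendsto_eq_intros lim_t)
  have num: "((\<lambda>t. norm (q t - q r) + \<bar>t - r\<bar> * k * norm (x r)) \<longlongrightarrow> 0) (at r within S)"
    by (intro tendsto_add_zero qlim tendsto_mult_left_zero lim_t)
  have "((\<lambda>t. (norm (q t - q r) + \<bar>t - r\<bar> * k * norm (x r)) / (c - \<bar>t - r\<bar> * k)) \<longlongrightarrow> 0) (at r within S)"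
    using tendsto_divide[OF num den] c(1) by simp
  moreover have "\<forall>\<^sub>F t in at r within S. norm (x t - x r) \<le>
      (norm (q t - q r) + \<bar>t - r\<bar> * k * norm (x r)) / (c - \<bar>t - r\<bar> * k)"
    using order_tendstoD(1)[OF den c(1)] eventually_at_topological
    by (auto simp: eventually_at_filter field_simps elim!: eventually_mono dest!: bound)
  ultimately have "((\<lambda>t. x t - x r) \<longlongrightarrow> 0) (at r within S)"
    by (rule Lim_null_comparison [rotated])
  then show "(x \<longlongrightarrow> x r) (at r within S)"
    by (simp add: LIM_zero_iff)
qed

lemma pos_def_path:
  fixes f :: "real \<Rightarrow> real^'n^'n"
  assumes cont: "continuous_on {0..1} f" and start: "pos_def (f 0)"
    and sym: "\<And>t. t \<in> {0..1} \<Longrightarrow> (f t)\<^sup>T = f t"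
    and nonsing: "\<And>t v. t \<in> {0..1} \<Longrightarrow> pos_semidef (f t) \<Longrightarrow> f t *v v = 0 \<Longrightarrow> v = 0"
  shows "pos_def (f 1)"
proof (rule ccontr)
  assume not: "\<not> pos_def (f 1)"
  define h where "h z = snd z \<bullet> (f (fst z) *v snd z)" for z
  define Z where "Z = {z \<in> {0..1} \<times> sphere 0 1. h z \<le> 0}"
  have bb: "bounded_bilinear (\<lambda>(M :: real^'n^'n) x. M *v x)"
    unfolding bilinear_conv_bounded_bilinear [symmetric] bilinear_def
    by (auto intro!: linearI simp: algebra_simps scaleR_matrix_vector_assoc)
  have cont_fst: "continuous_on ({0..1} \<times> sphere 0 1) (\<lambda>z. f (fst z))"
    by (rule continuous_on_compose2[OF cont]) (auto intro!: continuous_on_fst)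
  have "continuous_on ({0..1} \<times> sphere 0 1) h"
    unfolding h_def
    by (intro continuous_on_inner bounded_bilinear.continuous_on[OF bb] continuous_on_snd
        continuous_on_id cont_fst)
  then have "closed Z"
    unfolding Z_def
    by (intro continuous_on_closed_Collect_le) (auto intro!: closed_Times)
  then have "compact (({0..1} \<times> sphere 0 1) \<inter> Z)"
    by (intro compact_Int_closed compact_Times) auto
  moreover have "({0..1} \<times> sphere 0 1) \<inter> Z = Z"
    by (auto simp: Z_def)
  ultimately have compact: "compact (fst ` Z)"
    by (auto intro!: compact_continuous_image continuous_on_fst)
  have PD: "pos_def (f t)" if t: "t \<in> {0..1}" "t \<notin> fst ` Z" for t
  proof -
    have "0 < x \<bullet> (f t *v x)" if "x \<noteq> 0" for x
    proof -
      have "(t, x /\<^sub>R norm x) \<notin> Z"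
        using t(2) by force
      then have "0 < (x /\<^sub>R norm x) \<bullet> (f t *v (x /\<^sub>R norm x))"
        using t(1) that by (auto simp: Z_def h_def)
      then show ?thesis
        using that by (simp add: matrix_vector_mult_scaleR zero_less_mult_iff)
    qed
    with sym[OF t(1)] show ?thesis
      by (simp add: pos_def_def)
  qed
  have "fst ` Z \<noteq> {}"
    using not PD[of 1] by auto
  then obtain r where r: "r \<in> fst ` Z" and least: "\<And>t. t \<in> fst ` Z \<Longrightarrow> r \<le> t"
    using compact_attains_inf[OF compact] by blast
  from r obtain v where v: "r \<in> {0..1}" "norm v = 1" "v \<bullet> (f r *v v) \<le> 0"
    by (auto simp: Z_def h_def)
  have semi: "pos_semidef (f r)"
  proof -
    have "0 \<le> x \<bullet> (f r *v x)" for x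
    proof (rule ccontr)
      assume "\<not> ?thesis"
      then have neg: "x \<bullet> (f r *v x) < 0"
        by simp
      then have "x \<noteq> 0"
        by auto
      have "continuous_on {0..r} (\<lambda>t. x \<bullet> (f t *v x))"
        using v(1) by (intro continuous_on_inner bounded_bilinear.continuous_on[OF bb]
            continuous_on_const continuous_on_subset[OF cont]) auto
      moreover have "0 < x \<bullet> (f 0 *v x)"
        using start \<open>x \<noteq> 0\<close> by (simp add: pos_def_def)
      ultimately obtain t where t: "0 \<le> t" "t \<le> r" "x \<bullet> (f t *v x) = 0"
        using IVT2'[of "\<lambda>t. x \<bullet> (f t *v x)" r 0 0] neg v(1) by auto
      with neg have "t \<noteq> r"
        by auto
      with t least v(1) have "pos_def (f t)"
        by (intro PD) force+
      with t(3) \<open>x \<noteq> 0\<close> show False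
        unfolding pos_def_def by (metis less_irrefl)
    qed
    with sym[OF v(1)] show ?thesis
      by (simp add: pos_semidef_def)
  qed
  moreover have "v \<bullet> (f r *v v) = 0"
    using semi v(3) by (simp add: pos_semidef_def order_antisym)
  ultimately have "f r *v v = 0"
    by (rule pos_semidef_null)
  then have "v = 0"
    using nonsing v(1) semi by blast
  with v(2) show False
    by simp
qed

lemma lyapunov_nonsingular:
  assumes "pos_semidef X" "M ** X + X ** M\<^sup>T + Q = 0" "pos_def Q" "X *v v = 0"
  shows "v = 0"
proof (rule ccontr)
  assume "v \<noteq> 0"
  have "v \<bullet> ((M ** X) *v v) = 0"
    by (simp add: matrix_vector_mul_assoc [symmetric] assms(4))
  moreover have "v \<bullet> ((X ** M\<^sup>T) *v v) = 0"
    using assms(1,4)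
    by (simp add: matrix_vector_mul_assoc [symmetric] inner_transpose[of _ X] pos_semidef_def)
  moreover have "v \<bullet> ((M ** X + X ** M\<^sup>T + Q) *v v) = 0"
    by (simp add: assms(2))
  ultimately have "v \<bullet> (Q *v v) = 0"
    by (simp add: matrix_vector_mult_add_rdistrib inner_add_right)
  with \<open>v \<noteq> 0\<close> assms(3) show False
    unfolding pos_def_def by (metis less_irrefl)
qed

lemma linear_sylvester: "linear (\<lambda>X :: real^'k^'n. M ** X + X ** N)"
  by (rule linearI) (simp_all add: mat_ring algebra_simps)

lemma lyapunov_inj:
  assumes "hurwitz M"
  shows "inj (\<lambda>X. M ** X + X ** M\<^sup>T)"
  unfolding linear_injective_0[OF linear_sylvester]
  using sylvester_unique[OF assms assms] by blast

lemma lyapunov_exists: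
  assumes "hurwitz M"
  shows "\<exists>X. M ** X + X ** M\<^sup>T + Q = 0"
proof -
  have "surj (\<lambda>X. M ** X + X ** M\<^sup>T)"
    by (rule linear_injective_imp_surjective[OF linear_sylvester lyapunov_inj[OF assms]]) (rule refl)
  from surjD[OF this, of "- Q"] obtain X where "- Q = M ** X + X ** M\<^sup>T"
    by (elim exE)
  then have "M ** X + X ** M\<^sup>T + Q = 0"
    by (simp flip: \<open>- Q = _\<close>)
  then show ?thesis by (rule exI)
qed

lemma lyapunov_unique:
  assumes "hurwitz M" "M ** X + X ** M\<^sup>T + Q = 0" "M ** Y + Y ** M\<^sup>T + Q = 0"
  shows "X = Y"
proof -
  have "M ** (X - Y) + (X - Y) ** M\<^sup>T = (M ** X + X ** M\<^sup>T + Q) - (M ** Y + Y ** M\<^sup>T + Q)"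
    by (simp add: mat_ring)
  then have "M ** (X - Y) + (X - Y) ** M\<^sup>T = 0"
    by (simp only: assms diff_self)
  then have "X - Y = 0"
    by (rule sylvester_unique[OF assms(1) assms(1)])
  then show ?thesis by simp
qed

lemma lyapunov_symmetric:
  assumes "hurwitz M" "M ** X + X ** M\<^sup>T + Q = 0" "Q\<^sup>T = Q"
  shows "X\<^sup>T = X"
proof (rule lyapunov_unique[OF assms(1) _ assms(2)])
  have "(M ** X + X ** M\<^sup>T + Q)\<^sup>T = 0"
    by (simp add: assms(2))
  then show "M ** X\<^sup>T + X\<^sup>T ** M\<^sup>T + Q = 0"
    by (simp add: transpose_simps assms(3) add.commute)
qed

lemma lyapunov_pos_def_of_certificate:
  assumes Y: "pos_def Y" "M ** Y + Y ** M\<^sup>T + R = 0" "pos_def R"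
    and X: "X\<^sup>T = X" "M ** X + X ** M\<^sup>T + Q = 0" "pos_def Q"
  shows "pos_def X"
proof -
  define f where "f t = (1 - t) *\<^sub>R Y + t *\<^sub>R X" for t :: real
  have "pos_def (f 1)"
  proof (rule pos_def_path)
    show "continuous_on {0..1} f"
      unfolding f_def by (intro continuous_intros)
    show "pos_def (f 0)"
      by (simp add: f_def Y)
    show "(f t)\<^sup>T = f t" for t
      using X(1) Y(1) by (simp add: f_def transpose_simps pos_def_def)
    show "v = 0" if t: "t \<in> {0..1}" and "pos_semidef (f t)" "f t *v v = 0" for t v
    proof (rule lyapunov_nonsingular[OF that(2) _ _ that(3)])
      let ?S = "(1 - t) *\<^sub>R R + t *\<^sub>R Q"
      have "M ** f t + f t ** M\<^sup>T + ?S
          = (1 - t) *\<^sub>R (M ** Y + Y ** M\<^sup>T + R) + t *\<^sub>R (M ** X + X ** M\<^sup>T + Q)"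
        by (simp add: f_def mat_ring algebra_simps)
      then show "M ** f t + f t ** M\<^sup>T + ?S = 0"
        by (simp add: X Y)
      show "pos_def ?S"
      proof (cases "t = 0")
        case True
        then show ?thesis by (simp add: Y)
      next
        case False
        then have "pos_def (t *\<^sub>R Q + (1 - t) *\<^sub>R R)"
          using t by (intro pos_def_add pos_def_scaleR X pos_semidef_scaleR pos_def_imp_semidef Y) auto
        then show ?thesis by (simp add: add.commute)
      qed
    qed
  qed
  then show ?thesis
    by (simp add: f_def)
qed

lemma hurwitz_shift:
  assumes "hurwitz M" "0 \<le> s"
  shows "hurwitz (M - s *\<^sub>R mat 1)"
  unfolding hurwitz_iff_real
proof (intro allI impI)
  fix r w a b
  assume "(a \<noteq> 0 \<or> b \<noteq> 0) \<and> (M - s *\<^sub>R mat 1) *v a = r *\<^sub>R a - w *\<^sub>R b \<and>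
    (M - s *\<^sub>R mat 1) *v b = w *\<^sub>R a + r *\<^sub>R b"
  then have "(a \<noteq> 0 \<or> b \<noteq> 0) \<and> M *v a = (r + s) *\<^sub>R a - w *\<^sub>R b \<and> M *v b = w *\<^sub>R a + (r + s) *\<^sub>R b"
    by (simp add: matrix_vector_mult_diff_rdistrib scaleR_matrix_vector_assoc [symmetric] algebra_simps)
  then have "r + s < 0"
    using assms(1) unfolding hurwitz_iff_real by blast
  with assms(2) show "r < 0" by simp
qed

text \<open>
  Follow the solution of the Lyapunov equation for \<open>M - s I\<close> from a large \<open>s\<close>, where the identity
  is a certificate, down to \<open>s = 0\<close>: it cannot become singular while it is semidefinite.
\<close>

lemma lyapunov_pos_def:
  assumes M: "hurwitz M" and X: "M ** X + X ** M\<^sup>T + Q = 0" and Q: "pos_def Q"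
  shows "pos_def X"
proof -
  have symQ: "Q\<^sup>T = Q"
    using Q by (simp add: pos_def_def)
  obtain c where c: "0 < c" "\<And>x. norm (M *v x) \<le> c * norm x"
    using linear_bounded_pos[OF matrix_vector_mul_linear[of M]] by blast
  define s where "s t = (1 - t) * (c + 1)" for t
  define N where "N t = M - s t *\<^sub>R mat 1" for t
  have hN: "hurwitz (N t)" if "t \<in> {0..1}" for t
    unfolding N_def using that c(1) by (intro hurwitz_shift M) (simp add: s_def)
  have "\<exists>Y. t \<in> {0..1} \<longrightarrow> N t ** Y + Y ** (N t)\<^sup>T + Q = 0" for t
    using lyapunov_exists[OF hN] by blast
  then obtain Y where Y: "\<And>t. t \<in> {0..1} \<Longrightarrow> N t ** Y t + Y t ** (N t)\<^sup>T + Q = 0"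
    by metis
  have symY: "(Y t)\<^sup>T = Y t" if "t \<in> {0..1}" for t
    using lyapunov_symmetric[OF hN[OF that] Y[OF that] symQ] .
  define U where "U X = N 0 ** X + X ** (N 0)\<^sup>T" for X
  define V where "V X = (c + 1) *\<^sub>R (X + X)" for X :: "real^'a^'a"
  have UV: "U X + t *\<^sub>R V X = N t ** X + X ** (N t)\<^sup>T" for t X
    by (simp add: U_def V_def N_def s_def mat_ring algebra_simps)
  have cont: "continuous_on {0..1} Y"
  proof (rule affine_family_continuous)
    show "linear U" "linear V"
      unfolding U_def V_def by (rule linear_sylvester) (rule linearI, simp_all add: algebra_simps)
    show "inj (\<lambda>x. U x + t *\<^sub>R V x)" if "t \<in> {0..1}" for t
      unfolding UV by (rule lyapunov_inj[OF hN[OF that]])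
    show "U (Y t) + t *\<^sub>R V (Y t) = - Q" if "t \<in> {0..1}" for t
      unfolding UV using Y[OF that] by (simp add: eq_neg_iff_add_eq_0)
  qed simp
  have "pos_def (Y 1)"
  proof (rule pos_def_path[OF cont _ symY])
    show "v = 0" if "t \<in> {0..1}" "pos_semidef (Y t)" "Y t *v v = 0" for t v
      using lyapunov_nonsingular[OF that(2) Y[OF that(1)] Q that(3)] .
    show "pos_def (Y 0)"
    proof (rule lyapunov_pos_def_of_certificate)
      show "N 0 ** mat 1 + mat 1 ** (N 0)\<^sup>T + - (N 0 + (N 0)\<^sup>T) = 0"
        by simp
      show "pos_def (- (N 0 + (N 0)\<^sup>T))"
        unfolding pos_def_def
      proof (intro conjI allI impI)
        show "(- (N 0 + (N 0)\<^sup>T))\<^sup>T = - (N 0 + (N 0)\<^sup>T)"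
          by (simp add: transpose_simps)
        fix x :: "real^'a" assume "x \<noteq> 0"
        have "x \<bullet> (M *v x) \<le> norm x * (c * norm x)"
          using norm_cauchy_schwarz[of x "M *v x"] c(2)[of x]
          by (meson order_trans mult_left_mono norm_ge_zero)
        then have "x \<bullet> (M *v x) \<le> c * (x \<bullet> x)"
          by (simp add: dot_square_norm power2_eq_square algebra_simps)
        moreover have "0 < x \<bullet> x"
          using \<open>x \<noteq> 0\<close> by simp
        moreover have "x \<bullet> (N 0 *v x) = x \<bullet> (M *v x) - (c + 1) * (x \<bullet> x)"
          by (simp add: N_def s_def matrix_vector_mult_diff_rdistrib
              scaleR_matrix_vector_assoc [symmetric] inner_diff_right)
        ultimately have "x \<bullet> (N 0 *v x) < 0"
          by (simp add: algebra_simps del: inner_gt_zero_iff)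
        moreover have "x \<bullet> ((N 0)\<^sup>T *v x) = x \<bullet> (N 0 *v x)"
          by (subst inner_transpose) (simp add: inner_commute)
        ultimately show "0 < x \<bullet> ((- (N 0 + (N 0)\<^sup>T)) *v x)"
          by (simp add: matrix_vector_uminus matrix_vector_mult_diff_rdistrib inner_diff_right)
      qed
      show "N 0 ** Y 0 + Y 0 ** (N 0)\<^sup>T + Q = 0"
        by (rule Y) simp
      show "(Y 0)\<^sup>T = Y 0"
        by (rule symY) simp
    qed (rule pos_def_mat_1 Q)+
  qed auto
  moreover have "Y 1 = X"
    by (rule lyapunov_unique[OF M _ X]) (use Y[of 1] in \<open>simp add: N_def s_def\<close>)
  ultimately show ?thesis by simp
qed

lemma lyapunov_pos_semidef:
  assumes M: "hurwitz M" and X: "M ** X + X ** M\<^sup>T + Q = 0" and Q: "pos_semidef Q"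
  shows "pos_semidef X"
  unfolding pos_semidef_def
proof (intro conjI allI)
  show "X\<^sup>T = X"
    using lyapunov_symmetric[OF M X] Q by (simp add: pos_semidef_def)
  obtain Y where Y: "M ** Y + Y ** M\<^sup>T + mat 1 = 0"
    using lyapunov_exists[OF M] by blast
  fix x
  have pos: "0 \<le> x \<bullet> (X *v x) + e * (x \<bullet> (Y *v x))" if "0 < e" for e
  proof -
    have "pos_def (X + e *\<^sub>R Y)"
    proof (rule lyapunov_pos_def[OF M])
      have "M ** (X + e *\<^sub>R Y) + (X + e *\<^sub>R Y) ** M\<^sup>T + (e *\<^sub>R mat 1 + Q)
          = (M ** X + X ** M\<^sup>T + Q) + e *\<^sub>R (M ** Y + Y ** M\<^sup>T + mat 1)"
        by (simp add: mat_ring algebra_simps)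
      then show "M ** (X + e *\<^sub>R Y) + (X + e *\<^sub>R Y) ** M\<^sup>T + (e *\<^sub>R mat 1 + Q) = 0"
        by (simp add: X Y)
      show "pos_def (e *\<^sub>R mat 1 + Q)"
        by (intro pos_def_add pos_def_scaleR pos_def_mat_1 that Q)
    qed
    then have "pos_semidef (X + e *\<^sub>R Y)"
      by (rule pos_def_imp_semidef)
    then show ?thesis
      by (simp add: pos_semidef_def matrix_vector_mult_add_rdistrib scaleR_matrix_vector_assoc [symmetric]
          inner_add_right)
  qed
  have "((\<lambda>e. x \<bullet> (X *v x) + e * (x \<bullet> (Y *v x))) \<longlongrightarrow> x \<bullet> (X *v x)) (at_right 0)"
    by (auto intro!: tendsto_eq_intros)
  then show "0 \<le> x \<bullet> (X *v x)"
    by (rule tendsto_lowerbound)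
      (auto intro: eventually_mono[OF eventually_at_right_less[of 0] pos])
qed

section \<open>The Riccati equation\<close>

locale kalman =
  fixes A :: "real^'n^'n" and C :: "real^'n^'m" and W1 :: "real^'n^'n" and W2 :: "real^'m^'m"
  assumes A: "hurwitz A" and W1: "pos_def W1" and W2: "pos_def W2"
begin

abbreviation "V2 \<equiv> matrix_inv W2"

definition ric :: "real^'n^'n \<Rightarrow> real^'n^'n" where
  "ric P = A ** P + P ** A\<^sup>T - P ** C\<^sup>T ** V2 ** C ** P + W1"

lemma W2_inv: "W2 ** V2 = mat 1" "V2 ** W2 = mat 1"
  using W2 pos_def_invertible matrix_inv_left matrix_inv_right by auto

lemma W2_inv': "M ** W2 ** V2 = M" "M ** V2 ** W2 = M"
  using W2_inv by (simp_all flip: matrix_mul_assoc)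

lemma sym_W2: "W2\<^sup>T = W2" and sym_V2: "V2\<^sup>T = V2"
  using W2 pos_def_inverse[OF W2] by (auto simp: pos_def_def)

lemma gain_identity:
  assumes "P\<^sup>T = P" and L: "L = P ** C\<^sup>T ** V2"
  shows "(A - B ** C) ** P + P ** (A - B ** C)\<^sup>T + (W1 + B ** W2 ** B\<^sup>T)
    = ric P + (B - L) ** W2 ** (B - L)\<^sup>T"
  by (simp add: L ric_def mat_ring assms(1) sym_V2 W2_inv')

lemma pos_def_forcing: "pos_def (W1 + B ** W2 ** B\<^sup>T)"
  by (intro pos_def_add W1 pos_semidef_congruence pos_def_imp_semidef W2)

lemma riccati_hurwitz:
  assumes "pos_semidef P" "pos_semidef (- ric P)"
  shows "hurwitz (A - P ** C\<^sup>T ** V2 ** C)"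
proof -
  let ?L = "P ** C\<^sup>T ** V2"
  have "(A - ?L ** C) ** P + P ** (A - ?L ** C)\<^sup>T + ((W1 + ?L ** W2 ** ?L\<^sup>T) + - ric P) = 0"
    using gain_identity[of P ?L ?L] assms(1) by (simp add: pos_semidef_def algebra_simps)
  moreover have "pos_def ((W1 + ?L ** W2 ** ?L\<^sup>T) + - ric P)"
    by (intro pos_def_add pos_def_forcing assms)
  ultimately show ?thesis
    using hurwitz_certificate[OF assms(1)] by blast
qed

lemma riccati_newton_step:
  assumes P: "pos_semidef P" "pos_semidef (- ric P)"
  obtains P' where "pos_semidef P'" "pos_semidef (- ric P')" "pos_semidef (P - P')"
    "P' = P \<Longrightarrow> ric P = 0"
proof -
  define L where "L = P ** C\<^sup>T ** V2"
  let ?M = "A - L ** C"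
  have M: "hurwitz ?M"
    using riccati_hurwitz[OF P] by (simp add: L_def)
  have symP: "P\<^sup>T = P"
    using P by (simp add: pos_semidef_def)
  have eqP: "?M ** P + P ** ?M\<^sup>T + (W1 + L ** W2 ** L\<^sup>T) = ric P"
    using gain_identity[OF symP L_def, of L] by simp
  obtain P' where P': "?M ** P' + P' ** ?M\<^sup>T + (W1 + L ** W2 ** L\<^sup>T) = 0"
    using lyapunov_exists[OF M] by blast
  have semiP': "pos_semidef P'"
    by (rule lyapunov_pos_semidef[OF M P' pos_def_imp_semidef[OF pos_def_forcing]])
  define L' where "L' = P' ** C\<^sup>T ** V2"
  have "ric P' + (L - L') ** W2 ** (L - L')\<^sup>T = 0"
    using gain_identity[OF _ L'_def, of L] semiP' P' by (simp add: pos_semidef_def)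
  then have "- ric P' = (L - L') ** W2 ** (L - L')\<^sup>T"
    by (simp add: neg_eq_iff_add_eq_0)
  then have ric': "pos_semidef (- ric P')"
    by (simp add: pos_semidef_congruence pos_def_imp_semidef W2)
  have diff: "?M ** (P - P') + (P - P') ** ?M\<^sup>T = ric P"
  proof -
    have "?M ** (P - P') + (P - P') ** ?M\<^sup>T
        = (?M ** P + P ** ?M\<^sup>T + (W1 + L ** W2 ** L\<^sup>T)) - (?M ** P' + P' ** ?M\<^sup>T + (W1 + L ** W2 ** L\<^sup>T))"
      by (simp add: matmul.diff_left matmul.diff_right)
    then show ?thesis
      by (simp only: eqP P' diff_0_right)
  qed
  have "?M ** (P - P') + (P - P') ** ?M\<^sup>T + - ric P = 0"
    by (simp add: diff)
  then have "pos_semidef (P - P')"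
    by (rule lyapunov_pos_semidef[OF M _ P(2)])
  moreover have "ric P = 0" if "P' = P"
    using diff unfolding that by (simp add: matmul.zero_left matmul.zero_right)
  ultimately show thesis
    using that semiP' ric' by blast
qed

lemma continuous_ric: "continuous_on UNIV ric"
  unfolding ric_def by (intro continuous_intros matmul.continuous_on)

lemma closed_pos_semidef: "closed {M :: real^'k^'k. pos_semidef M}"
proof -
  have "linear (transpose :: real^'k^'k \<Rightarrow> _)"
    by (rule linearI) (simp_all add: transpose_add transpose_scalar)
  then have 1: "continuous_on UNIV (transpose :: real^'k^'k \<Rightarrow> _)"
    by (simp add: linear_continuous_on linear_linear)
  have "linear (\<lambda>M. x \<bullet> (M *v x))" for x :: "real^'k"
    by (rule linearI)
      (simp_all add: matrix_vector_mult_add_rdistrib inner_add_right scaleR_matrix_vector_assoc [symmetric])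
  then have 2: "continuous_on UNIV (\<lambda>M. x \<bullet> (M *v x))" for x :: "real^'k"
    by (simp add: linear_continuous_on linear_linear)
  show ?thesis
    unfolding pos_semidef_def
    by (intro closed_Collect_conj closed_Collect_all closed_Collect_eq closed_Collect_le 1 2
        continuous_intros)
qed

text \<open>A solution of minimal trace of the Riccati inequality is a fixed point of the Newton step.\<close>

lemma riccati_solution_exists: "\<exists>P. pos_semidef P \<and> ric P = 0"
proof -
  obtain X where X: "A ** X + X ** A\<^sup>T + W1 = 0"
    using lyapunov_exists[OF A] by blast
  have semiX: "pos_semidef X"
    by (rule lyapunov_pos_semidef[OF A X pos_def_imp_semidef[OF W1]])
  have "- ric X = (X ** C\<^sup>T) ** V2 ** (X ** C\<^sup>T)\<^sup>T"
    using X semiX by (simp add: ric_def pos_semidef_def mat_ring algebra_simps)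
  then have ricX: "pos_semidef (- ric X)"
    by (simp only: pos_semidef_congruence pos_def_imp_semidef pos_def_inverse W2)
  define F where "F = {P. pos_semidef P} \<inter> {P. pos_semidef (- ric P)} \<inter> {P. trace P \<le> trace X}"
  have "closed {P. pos_semidef (- ric P)}"
    using continuous_closed_vimage[OF closed_pos_semidef, of "\<lambda>P. - ric P"] continuous_ric
    by (simp add: vimage_def continuous_on_eq_continuous_at continuous_minus)
  moreover have cont: "continuous_on UNIV (trace :: real^'n^'n \<Rightarrow> real)"
    by (rule linear_continuous_on[OF bounded_linear_trace])
  then have "closed {P :: real^'n^'n. trace P \<le> trace X}"
    by (intro closed_Collect_le continuous_on_const)
  ultimately have "closed F"
    unfolding F_def by (intro closed_Int closed_pos_semidef)
  moreover have "bounded F"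
  proof -
    have "norm P \<le> (\<Sum>i\<in>(UNIV :: 'n set). \<Sum>j\<in>(UNIV :: 'n set). trace X)" if "P \<in> F" for P
    proof -
      have "norm P \<le> (\<Sum>i\<in>UNIV. norm (P $ i))"
        unfolding norm_vec_def[of P] by (rule L2_set_le_sum) simp
      also have "\<dots> \<le> (\<Sum>i\<in>UNIV. \<Sum>j\<in>UNIV. \<bar>P $ i $ j\<bar>)"
        by (intro sum_mono norm_le_l1_cart)
      also have "\<dots> \<le> (\<Sum>i\<in>(UNIV :: 'n set). \<Sum>j\<in>(UNIV :: 'n set). trace X)"
        by (intro sum_mono order_trans[OF pos_semidef_entry_le_trace]) (use that in \<open>simp_all add: F_def\<close>)
      finally show ?thesis .
    qed
    then show ?thesis
      unfolding bounded_iff by blast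
  qed
  ultimately have "compact F"
    by (simp add: compact_eq_bounded_closed)
  moreover have "X \<in> F"
    by (simp add: F_def semiX ricX)
  ultimately obtain P where P: "P \<in> F" and least: "\<And>P'. P' \<in> F \<Longrightarrow> trace P \<le> trace P'"
    using continuous_attains_inf[of F trace] cont continuous_on_subset by blast
  from P have semi: "pos_semidef P" "pos_semidef (- ric P)" and trP: "trace P \<le> trace X"
    by (auto simp: F_def)
  obtain P' where P': "pos_semidef P'" "pos_semidef (- ric P')" "pos_semidef (P - P')"
    "P' = P \<Longrightarrow> ric P = 0"
    using riccati_newton_step[OF semi] by blast
  have "trace P' \<le> trace P"
    using pos_semidef_trace[OF P'(3)] by (simp add: trace_sub)
  then have "trace (P - P') = 0"
    using least[of P'] P' trP by (simp add: F_def trace_sub)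
  then have "P - P' = 0"
    by (rule pos_semidef_trace_0[OF P'(3)])
  with P'(4) semi(1) show ?thesis
    by auto
qed

lemma riccati_solution_unique:
  assumes "P\<^sup>T = P" "ric P = 0" "hurwitz (A - P ** C\<^sup>T ** V2 ** C)"
    and "R\<^sup>T = R" "ric R = 0" "hurwitz (A - R ** C\<^sup>T ** V2 ** C)"
  shows "P = R"
proof -
  have "(A - P ** C\<^sup>T ** V2 ** C) ** (P - R) + (P - R) ** (A - R ** C\<^sup>T ** V2 ** C)\<^sup>T = ric P - ric R"
    by (simp add: ric_def mat_ring assms(1,4) sym_V2)
  also have "\<dots> = 0"
    by (simp add: assms(2,5))
  finally have "P - R = 0"
    by (rule sylvester_unique[OF assms(3,6)])
  then show ?thesis by simp
qed

abbreviation "Ps \<equiv> P_star A C W1 W2"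
abbreviation "Ls \<equiv> L_star A C W1 W2"

lemma stabilizing_iff:
  "stabilizing_riccati_solution A C W1 W2 P \<longleftrightarrow>
     pos_semidef P \<and> ric P = 0 \<and> hurwitz (A - P ** C\<^sup>T ** V2 ** C)"
  by (simp add: stabilizing_riccati_solution_def ric_def)

lemma P_star_eq:
  assumes "stabilizing_riccati_solution A C W1 W2 P"
  shows "Ps = P"
  unfolding P_star_def
  using assms by (intro the_equality) (auto simp: stabilizing_iff pos_semidef_def intro: riccati_solution_unique)

lemma P_star: "pos_semidef Ps" "ric Ps = 0" "hurwitz (A - Ls ** C)"
proof -
  obtain P where P: "pos_semidef P" "ric P = 0"
    using riccati_solution_exists by blast
  moreover have "pos_semidef (0 :: real^'n^'n)"
    by (simp add: pos_semidef_def)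
  ultimately have "stabilizing_riccati_solution A C W1 W2 P"
    using riccati_hurwitz[of P] by (simp add: stabilizing_iff)
  moreover from this have "Ps = P"
    by (rule P_star_eq)
  ultimately show "pos_semidef Ps" "ric Ps = 0" "hurwitz (A - Ls ** C)"
    by (simp_all add: stabilizing_iff L_star_def)
qed

lemma sym_Ps: "Ps\<^sup>T = Ps"
  using P_star(1) by (simp add: pos_semidef_def)

lemma L_star_W2: "Ls ** W2 = Ps ** C\<^sup>T"
  by (simp add: L_star_def W2_inv')

end

section \<open>Controllability\<close>

lemma summable_mat_exp:
  fixes M :: "real^'n^'n"
  shows "summable (\<lambda>k. (1 / fact k) *\<^sub>R ((\<lambda>X. M ** X) ^^ k) (mat 1 :: real^'n^'n))"
proof -
  obtain d where "0 < d" and "\<And>X :: real^'n^'n. norm (M ** X) \<le> norm X * d"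
    using bounded_linear.pos_bounded[OF matmul.bounded_linear_right[of M]] by blast
  then have d: "0 \<le> d" "norm (M ** X) \<le> d * norm X" for X :: "real^'n^'n"
    by (simp_all add: mult.commute)
  let ?I = "mat 1 :: real^'n^'n"
  have pow: "norm (((\<lambda>X. M ** X) ^^ k) ?I) \<le> d ^ k * norm ?I" for k
  proof (induction k)
    case (Suc k)
    then show ?case
      using d order_trans[OF d(2) mult_left_mono[OF Suc d(1)]] by (simp add: mult.assoc)
  qed simp
  show ?thesis
  proof (rule summable_comparison_test')
    show "summable (\<lambda>k. (inverse (fact k) * d ^ k) * norm ?I)"
      by (intro summable_mult2 summable_exp)
    show "norm ((1 / fact k) *\<^sub>R ((\<lambda>X. M ** X) ^^ k) ?I) \<le> (inverse (fact k) * d ^ k) * norm ?I" for k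
      using mult_left_mono[OF pow[of k], of "inverse (fact k)"] by (simp add: divide_inverse mult.assoc)
  qed
qed

lemma mat_exp_annihilates:
  fixes M :: "real^'n^'n" and N :: "real^'n^'k"
  assumes "\<And>j. N *v (((*v) M ^^ j) v) = 0"
  shows "N *v (mat_exp (s *\<^sub>R M) *v v) = 0"
proof -
  have pow: "((\<lambda>X. (s *\<^sub>R M) ** X) ^^ k) (mat 1) *v v = s ^ k *\<^sub>R (((*v) M ^^ k) v)" for k
    by (induction k)
      (simp_all add: matrix_vector_mul_assoc [symmetric] matrix_vector_mult_scaleR
        scaleR_matrix_vector_assoc [symmetric])
  have "linear (\<lambda>X. N *v (X *v v))"
    by (rule linearI)
      (simp_all add: matrix_vector_mult_add_rdistrib matrix_vector_right_distrib matrix_vector_mult_scaleR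
        scaleR_matrix_vector_assoc [symmetric])
  then have bl: "bounded_linear (\<lambda>X. N *v (X *v v))"
    by (simp add: linear_linear)
  have "N *v (mat_exp (s *\<^sub>R M) *v v)
      = (\<Sum>k. N *v (((1 / fact k) *\<^sub>R ((\<lambda>X. (s *\<^sub>R M) ** X) ^^ k) (mat 1)) *v v))"
    unfolding mat_exp_def by (rule bounded_linear.suminf[OF bl summable_mat_exp])
  also have "\<dots> = 0"
    by (simp add: pow assms matrix_vector_mult_scaleR scaleR_matrix_vector_assoc [symmetric])
  finally show ?thesis .
qed

lemma controllable_trivial_kernel:
  fixes B :: "real^'m^'n"
  assumes "controllable M B" and v: "\<And>j. B\<^sup>T *v (((*v) (M\<^sup>T) ^^ j) v) = 0"
  shows "v = 0"
proof (rule ccontr)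
  assume "v \<noteq> 0"
  let ?f = "\<lambda>s. mat_exp (s *\<^sub>R M) ** B ** B\<^sup>T ** mat_exp (s *\<^sub>R M\<^sup>T)"
  have f: "?f s *v v = 0" for s
    using mat_exp_annihilates[OF v] by (simp add: matrix_vector_mul_assoc [symmetric])
  have "v \<bullet> (integral {0..} ?f *v v) = 0"
  proof (cases "?f integrable_on {0..}")
    case True
    have "linear (\<lambda>X. v \<bullet> (X *v v))"
      by (rule linearI)
        (simp_all add: matrix_vector_mult_add_rdistrib inner_add_right scaleR_matrix_vector_assoc [symmetric])
    then have "integral {0..} ((\<lambda>X. v \<bullet> (X *v v)) \<circ> ?f) = v \<bullet> (integral {0..} ?f *v v)"
      by (intro integral_linear True) (simp add: linear_linear)
    then show ?thesis
      by (simp add: o_def f)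
  qed (simp add: not_integrable_integral)
  moreover have "0 < v \<bullet> (integral {0..} ?f *v v)"
    using assms(1) \<open>v \<noteq> 0\<close> by (simp add: controllable_def pos_def_def)
  ultimately show False
    by simp
qed

section \<open>Block matrices\<close>

lemma sum_UNIV_sum: "(\<Sum>x\<in>UNIV. f x) = (\<Sum>a\<in>UNIV. f (Inl a)) + (\<Sum>b\<in>UNIV. f (Inr b))"
  for f :: "'a::finite + 'b::finite \<Rightarrow> 'c::comm_monoid_add"
  by (subst UNIV_Plus_UNIV [symmetric], subst sum.Plus) simp_all

lemma block_mat_mult:
  "block_mat P Q R S ** block_mat P' Q' R' S'
    = block_mat (P ** P' + Q ** R') (P ** Q' + Q ** S') (R ** P' + S ** R') (R ** Q' + S ** S')"
  by (simp add: vec_eq_iff block_mat_def matrix_matrix_mult_def sum_UNIV_sum split: sum.split)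

lemma block_mat_transpose: "(block_mat P Q R S)\<^sup>T = block_mat (P\<^sup>T) (R\<^sup>T) (Q\<^sup>T) (S\<^sup>T)"
  by (simp add: vec_eq_iff block_mat_def transpose_def split: sum.split)

lemma block_mat_add:
  "block_mat P Q R S + block_mat P' Q' R' S' = block_mat (P + P') (Q + Q') (R + R') (S + S')"
  by (simp add: vec_eq_iff block_mat_def split: sum.split)

lemma block_mat_0: "block_mat 0 0 0 0 = 0"
  by (simp add: vec_eq_iff block_mat_def split: sum.split)

lemma upper_right_block_mat: "upper_right (block_mat P Q R S) = Q"
  by (simp add: upper_right_def block_mat_def vec_eq_iff)

lemma block_row_mult_block_mat:
  "block_row P Q ** block_mat P' Q' R' S' = block_row (P ** P' + Q ** R') (P ** Q' + Q ** S')"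
  by (simp add: vec_eq_iff block_row_def block_mat_def matrix_matrix_mult_def sum_UNIV_sum split: sum.split)

lemma block_row_mult_transpose: "block_row P Q ** (block_row P' Q')\<^sup>T = P ** P'\<^sup>T + Q ** Q'\<^sup>T"
  by (simp add: vec_eq_iff block_row_def transpose_def matrix_matrix_mult_def sum_UNIV_sum)

lemma transpose_block_row_mult:
  "(block_row P Q)\<^sup>T ** block_row P' Q' = block_mat (P\<^sup>T ** P') (P\<^sup>T ** Q') (Q\<^sup>T ** P') (Q\<^sup>T ** Q')"
  by (simp add: vec_eq_iff block_row_def block_mat_def transpose_def matrix_matrix_mult_def split: sum.split)

lemma mult_block_row: "W ** block_row P Q = block_row (W ** P) (W ** Q)"
  by (simp add: vec_eq_iff block_row_def matrix_matrix_mult_def split: sum.split)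

definition block_vec :: "'a^'n \<Rightarrow> 'a^'m \<Rightarrow> 'a^('n + 'm)" where
  "block_vec u v = (\<chi> i. case i of Inl a \<Rightarrow> u $ a | Inr b \<Rightarrow> v $ b)"

lemma block_vec_surj: "\<exists>u v. x = block_vec u v"
  by (rule exI[of _ "\<chi> a. x $ Inl a"], rule exI[of _ "\<chi> b. x $ Inr b"])
    (simp add: block_vec_def vec_eq_iff split: sum.split)

lemma block_vec_eq_iff: "block_vec u v = block_vec u' v' \<longleftrightarrow> u = u' \<and> v = v'"
  by (auto simp: block_vec_def vec_eq_iff split: sum.splits)

lemma block_vec_0: "block_vec 0 0 = 0"
  by (simp add: block_vec_def vec_eq_iff split: sum.split)

lemma block_vec_linear:
  fixes u :: "real^'n" and v :: "real^'m"
  shows "c *\<^sub>R block_vec u v = block_vec (c *\<^sub>R u) (c *\<^sub>R v)"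
    and "block_vec u v + block_vec u' v' = block_vec (u + u') (v + v')"
    and "block_vec u v - block_vec u' v' = block_vec (u - u') (v - v')"
  by (simp_all add: block_vec_def vec_eq_iff split: sum.split)

lemma block_mat_mult_vec:
  "block_mat P Q R S *v block_vec u v = block_vec (P *v u + Q *v v) (R *v u + S *v v)"
  by (simp add: vec_eq_iff block_mat_def block_vec_def matrix_vector_mult_def sum_UNIV_sum split: sum.split)

lemma inner_block_vec: "block_vec u v \<bullet> block_vec u' v' = u \<bullet> u' + v \<bullet> (v' :: real^'m)"
  for u :: "real^'n"
  by (simp add: inner_vec_def block_vec_def sum_UNIV_sum)

lemma hurwitz_block_lower:
  assumes "hurwitz M" "hurwitz N"
  shows "hurwitz (block_mat M 0 F N)"
  unfolding hurwitz_iff_real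
proof (intro allI impI)
  fix s w a b
  assume ab: "(a \<noteq> 0 \<or> b \<noteq> 0) \<and> block_mat M 0 F N *v a = s *\<^sub>R a - w *\<^sub>R b \<and>
    block_mat M 0 F N *v b = w *\<^sub>R a + s *\<^sub>R b"
  obtain a1 a2 b1 b2 where eq: "a = block_vec a1 a2" "b = block_vec b1 b2"
    using block_vec_surj by metis
  have 1: "M *v a1 = s *\<^sub>R a1 - w *\<^sub>R b1" "M *v b1 = w *\<^sub>R a1 + s *\<^sub>R b1"
    and 2: "F *v a1 + N *v a2 = s *\<^sub>R a2 - w *\<^sub>R b2" "F *v b1 + N *v b2 = w *\<^sub>R a2 + s *\<^sub>R b2"
    using ab by (auto simp: eq block_mat_mult_vec block_vec_linear block_vec_eq_iff)
  show "s < 0"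
  proof (cases "a1 = 0 \<and> b1 = 0")
    case False
    then show ?thesis
      using assms(1) 1 unfolding hurwitz_iff_real by blast
  next
    case True
    then have "a2 \<noteq> 0 \<or> b2 \<noteq> 0"
      using ab block_vec_0 by (auto simp: eq)
    then show ?thesis
      using assms(2) 2 True unfolding hurwitz_iff_real by (metis matrix_vector_mult_0_right add_0)
  qed
qed

lemma pos_semidef_block_lower:
  assumes "pos_semidef (block_mat P R (R\<^sup>T) Y)"
  shows "pos_semidef Y" "Y *v v = 0 \<Longrightarrow> R *v v = 0"
proof -
  have sym: "block_mat (P\<^sup>T) R (R\<^sup>T) (Y\<^sup>T) = block_mat P R (R\<^sup>T) Y"
    using assms by (simp add: pos_semidef_def block_mat_transpose)
  have "Y\<^sup>T = Y"
  proof -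
    have "Y\<^sup>T $ i $ j = Y $ i $ j" for i j
      using arg_cong[OF sym, of "\<lambda>M. M $ Inr i $ Inr j"] by (simp add: block_mat_def)
    then show ?thesis
      by (simp add: vec_eq_iff)
  qed
  moreover have quad: "block_vec 0 u \<bullet> (block_mat P R (R\<^sup>T) Y *v block_vec 0 u) = u \<bullet> (Y *v u)" for u
    by (simp add: block_mat_mult_vec inner_block_vec)
  ultimately show "pos_semidef Y"
    using assms unfolding pos_semidef_def by metis
  assume "Y *v v = 0"
  then have "block_vec 0 v \<bullet> (block_mat P R (R\<^sup>T) Y *v block_vec 0 v) = 0"
    by (simp add: quad)
  then have "block_mat P R (R\<^sup>T) Y *v block_vec 0 v = 0"
    by (rule pos_semidef_null[OF assms])
  then show "R *v v = 0"
    by (simp add: block_mat_mult_vec block_vec_eq_iff flip: block_vec_0)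
qed

lemma hurwitz_intertwined:
  assumes "hurwitz M" "M ** T = T ** N" and inj: "\<And>x. T *v x = 0 \<Longrightarrow> x = 0"
  shows "hurwitz N"
  unfolding hurwitz_iff_real
proof (intro allI impI)
  fix s w a b
  assume ab: "(a \<noteq> 0 \<or> b \<noteq> 0) \<and> N *v a = s *\<^sub>R a - w *\<^sub>R b \<and> N *v b = w *\<^sub>R a + s *\<^sub>R b"
  have "M *v (T *v x) = T *v (N *v x)" for x
    by (simp add: matrix_vector_mul_assoc assms(2))
  then have "M *v (T *v a) = s *\<^sub>R (T *v a) - w *\<^sub>R (T *v b)"
    "M *v (T *v b) = w *\<^sub>R (T *v a) + s *\<^sub>R (T *v b)"
    using ab by (simp_all add: matrix_vector_mult_diff_distrib matrix_vector_right_distrib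
        matrix_vector_mult_scaleR)
  moreover have "T *v a \<noteq> 0 \<or> T *v b \<noteq> 0"
    using ab inj by blast
  ultimately show "s < 0"
    using assms(1) unfolding hurwitz_iff_real by blast
qed

section \<open>The stationary covariance of a filter\<close>

context kalman
begin

definition X :: "real^'n^'n" where
  "X = (SOME X. A ** X + X ** A\<^sup>T + W1 = 0)"

lemma X: "A ** X + X ** A\<^sup>T + W1 = 0"
  unfolding X_def by (rule someI_ex[OF lyapunov_exists[OF A]])

lemma pos_def_X: "pos_def X"
  by (rule lyapunov_pos_def[OF A X W1])

lemma sym_X: "X\<^sup>T = X"
  using pos_def_X by (simp add: pos_def_def)

text \<open>\<open>R\<close> and \<open>Y\<close> are the blocks \<open>\<Sigma>\<^sub>1\<^sub>2\<close> and \<open>\<Sigma>\<^sub>2\<^sub>2\<close> of the covariance.\<close>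

fun cov :: "('n, 'm, 'p::finite) filt \<Rightarrow> real^'n^'n \<Rightarrow> real^'n^'n \<Rightarrow> bool" where
  "cov (AK, B, CK) R Y \<longleftrightarrow>
     A ** R + X ** C\<^sup>T ** B\<^sup>T + R ** AK\<^sup>T = 0 \<and>
     AK ** Y + Y ** AK\<^sup>T + (B ** C ** R + R\<^sup>T ** C\<^sup>T ** B\<^sup>T + B ** W2 ** B\<^sup>T) = 0"

lemma cov_exists:
  assumes "hurwitz AK"
  obtains R Y where "cov (AK, B, CK) R Y"
proof -
  have "inj (\<lambda>R. A ** R + R ** AK\<^sup>T)"
    unfolding linear_injective_0[OF linear_sylvester] using sylvester_unique[OF A assms] by blast
  then have "surj (\<lambda>R. A ** R + R ** AK\<^sup>T)"
    by (rule linear_injective_imp_surjective[OF linear_sylvester]) (rule refl)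
  from surjD[OF this, of "- (X ** C\<^sup>T ** B\<^sup>T)"]
  obtain R where R: "- (X ** C\<^sup>T ** B\<^sup>T) = A ** R + R ** AK\<^sup>T"
    by (elim exE)
  have "A ** R + X ** C\<^sup>T ** B\<^sup>T + R ** AK\<^sup>T = (A ** R + R ** AK\<^sup>T) + X ** C\<^sup>T ** B\<^sup>T"
    by simp
  then have "A ** R + X ** C\<^sup>T ** B\<^sup>T + R ** AK\<^sup>T = 0"
    by (simp flip: R)
  then show thesis
    using lyapunov_exists[OF assms, of "B ** C ** R + R\<^sup>T ** C\<^sup>T ** B\<^sup>T + B ** W2 ** B\<^sup>T"] that
    by auto
qed

lemma hurwitz_A_cl: "hurwitz AK \<Longrightarrow> hurwitz (A_cl A C (AK, B, CK))"
  by (simp add: hurwitz_block_lower A)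

lemma Sigma_cl_cov:
  assumes AK: "hurwitz AK" and cov: "cov (AK, B, CK) R Y"
  shows "Sigma_cl A C W1 W2 (AK, B, CK) = block_mat X R (R\<^sup>T) Y"
proof -
  let ?M = "A_cl A C (AK, B, CK)"
  let ?S = "block_mat X R (R\<^sup>T) Y"
  have "(A ** R + X ** C\<^sup>T ** B\<^sup>T + R ** AK\<^sup>T)\<^sup>T = 0"
    using cov by simp
  then have t: "R\<^sup>T ** A\<^sup>T + (B ** C ** X + AK ** R\<^sup>T) = 0"
    by (simp add: mat_ring sym_X algebra_simps)
  have eq: "?M ** ?S + ?S ** ?M\<^sup>T + W_cl W1 W2 (AK, B, CK) = 0"
    using cov X t unfolding block_mat_0 [symmetric]
    by (simp add: block_mat_mult block_mat_transpose block_mat_add mat_ring algebra_simps)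
  show ?thesis
    unfolding Sigma_cl_def
  proof (rule the_equality)
    show "?M ** ?S + ?S ** ?M\<^sup>T + W_cl W1 W2 (AK, B, CK) = 0"
      by (rule eq)
    show "S = ?S" if "?M ** S + S ** ?M\<^sup>T + W_cl W1 W2 (AK, B, CK) = 0" for S
      by (rule lyapunov_unique[OF hurwitz_A_cl[OF AK] that eq])
  qed
qed

lemma cov_unique:
  assumes "hurwitz AK" "cov (AK, B, CK) R Y" "cov (AK, B, CK) R' Y'"
  shows "R = R'" "Y = Y'"
proof -
  have "block_mat X R (R\<^sup>T) Y = block_mat X R' (R'\<^sup>T) Y'"
    using assms Sigma_cl_cov by metis
  then have "upper_right (block_mat X R (R\<^sup>T) Y) = upper_right (block_mat X R' (R'\<^sup>T) Y')"
    by simp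
  then show R: "R = R'"
    by (simp add: upper_right_block_mat)
  show "Y = Y'"
    using assms unfolding R by (auto intro: lyapunov_unique[OF assms(1)])
qed

lemma K_info_iff:
  assumes "cov (AK, B, CK) R Y" "hurwitz AK"
  shows "(AK, B, CK) \<in> K_info A C W1 W2 \<longleftrightarrow> invertible R"
  using assms
  by (simp add: K_info_def K_stab_def Sigma_cl_cov upper_right_block_mat full_rank_injective
      invertible_iff_ker linear_injective_0)

lemma L_OE_cov:
  assumes "cov (AK, B, CK) R Y" "hurwitz AK"
  shows "L_OE A C G W1 W2 (AK, B, CK)
    = trace (G ** X ** G\<^sup>T) - 2 * trace (G ** R ** CK\<^sup>T) + trace (CK ** Y ** CK\<^sup>T)"
proof -
  have "trace (CK ** R\<^sup>T ** G\<^sup>T) = trace (G ** R ** CK\<^sup>T)"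
    using trace_transpose[of "G ** R ** CK\<^sup>T"] by (simp add: mat_ring)
  then show ?thesis
    by (simp add: L_OE_def Sigma_cl_cov[OF assms(2,1)] block_row_mult_block_mat block_row_mult_transpose
        mat_ring trace_add trace_sub trace_uminus)
qed

lemma cov_pushforward:
  assumes "cov (AK, B, CK) R Y" and M: "M ** J = J ** AK"
  shows "cov (M, J ** B, D) (R ** J\<^sup>T) (J ** Y ** J\<^sup>T)"
proof -
  have MT: "J\<^sup>T ** M\<^sup>T = AK\<^sup>T ** J\<^sup>T"
    using arg_cong[OF M, of transpose] by (simp add: matrix_transpose_mul)
  have MT': "N ** J\<^sup>T ** M\<^sup>T = N ** AK\<^sup>T ** J\<^sup>T" for N :: "real^'n^'n"
    by (simp add: MT flip: matrix_mul_assoc)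
  have "A ** (R ** J\<^sup>T) + X ** C\<^sup>T ** (J ** B)\<^sup>T + (R ** J\<^sup>T) ** M\<^sup>T
      = (A ** R + X ** C\<^sup>T ** B\<^sup>T + R ** AK\<^sup>T) ** J\<^sup>T"
    by (simp add: mat_ring MT')
  moreover have "M ** (J ** Y ** J\<^sup>T) + (J ** Y ** J\<^sup>T) ** M\<^sup>T +
        (J ** B ** C ** (R ** J\<^sup>T) + (R ** J\<^sup>T)\<^sup>T ** C\<^sup>T ** (J ** B)\<^sup>T + (J ** B) ** W2 ** (J ** B)\<^sup>T)
      = J ** (AK ** Y + Y ** AK\<^sup>T + (B ** C ** R + R\<^sup>T ** C\<^sup>T ** B\<^sup>T + B ** W2 ** B\<^sup>T)) ** J\<^sup>T"
    by (simp add: mat_ring MT' M)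
  ultimately show ?thesis
    using assms(1) by (simp add: matmul.zero_left matmul.zero_right)
qed

lemma hurwitz_similar:
  fixes AK S :: "real^'k^'k"
  assumes "hurwitz AK" "invertible S"
  shows "hurwitz (S ** AK ** matrix_inv S)"
proof (rule hurwitz_intertwined[OF assms(1)])
  show "AK ** matrix_inv S = matrix_inv S ** (S ** AK ** matrix_inv S)"
    by (simp add: matrix_mul_assoc matrix_inv_left[OF assms(2)])
  show "x = 0" if "matrix_inv S *v x = 0" for x
    using that invertible_matrix_inv[OF assms(2)] unfolding invertible_iff_ker by blast
qed

lemma cov_Sim:
  assumes "cov (AK, B, CK) R Y" "invertible S"
  shows "cov (Sim S (AK, B, CK)) (R ** S\<^sup>T) (S ** Y ** S\<^sup>T)"
  unfolding Sim.simps
  by (rule cov_pushforward[OF assms(1)])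
    (simp add: matrix_inv_left[OF assms(2)] flip: matrix_mul_assoc)

text \<open>
  The covariance of \<open>(x, x\<^sub>K)\<close> dominates that of the optimal estimation error \<open>x - x\<^sub>\<star>\<close>, since the
  difference solves a Lyapunov equation driven by the joint covariance of the innovation gains.
\<close>

lemma covariance_ge_Ps:
  assumes AK: "hurwitz AK" and cov: "cov (AK, B, CK) R Y"
  shows "pos_semidef (block_mat (X - Ps) R (R\<^sup>T) Y)"
proof (rule lyapunov_pos_semidef[OF hurwitz_A_cl[OF AK]])
  let ?M = "A_cl A C (AK, B, CK)"
  let ?S = "block_mat (X - Ps) R (R\<^sup>T) Y"
  let ?N = "(block_row (Ls\<^sup>T) (B\<^sup>T))\<^sup>T"
  have LT: "Ls\<^sup>T = V2 ** C ** Ps"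
    by (simp add: L_star_def mat_ring sym_Ps sym_V2)
  have N: "?N ** W2 ** ?N\<^sup>T
      = block_mat (Ps ** C\<^sup>T ** V2 ** C ** Ps) (Ps ** C\<^sup>T ** B\<^sup>T) (B ** C ** Ps) (B ** W2 ** B\<^sup>T)"
  proof -
    have "W2 ** ?N\<^sup>T = block_row (W2 ** Ls\<^sup>T) (W2 ** B\<^sup>T)"
      by (simp only: transpose_transpose mult_block_row)
    then have "?N ** W2 ** ?N\<^sup>T = ?N ** block_row (W2 ** Ls\<^sup>T) (W2 ** B\<^sup>T)"
      by (simp only: flip: matrix_mul_assoc)
    then show ?thesis
      unfolding transpose_block_row_mult
      by (simp add: LT L_star_def mat_ring sym_Ps sym_V2 W2_inv W2_inv')
  qed
  have "(A ** R + X ** C\<^sup>T ** B\<^sup>T + R ** AK\<^sup>T)\<^sup>T = 0"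
    using cov by simp
  then have t: "R\<^sup>T ** A\<^sup>T + (B ** C ** X + AK ** R\<^sup>T) = 0"
    by (simp add: mat_ring sym_X algebra_simps)
  have top: "A ** (X - Ps) + (X - Ps) ** A\<^sup>T + Ps ** C\<^sup>T ** V2 ** C ** Ps = 0"
  proof -
    have "A ** (X - Ps) + (X - Ps) ** A\<^sup>T + Ps ** C\<^sup>T ** V2 ** C ** Ps
        = (A ** X + X ** A\<^sup>T + W1) - ric Ps"
      by (simp add: ric_def mat_ring)
    then show ?thesis
      by (simp only: X P_star diff_self)
  qed
  have off: "A ** R + (X - Ps) ** (B ** C)\<^sup>T + R ** AK\<^sup>T + Ps ** C\<^sup>T ** B\<^sup>T = 0"
    "B ** C ** (X - Ps) + AK ** R\<^sup>T + R\<^sup>T ** A\<^sup>T + B ** C ** Ps = 0"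
    using cov t by (simp_all add: mat_ring algebra_simps)
  show "?M ** ?S + ?S ** ?M\<^sup>T + ?N ** W2 ** ?N\<^sup>T = 0"
    using cov top off unfolding N block_mat_0 [symmetric]
    by (simp add: block_mat_mult block_mat_transpose block_mat_add transpose_simps matrix_mul_assoc
        algebra_simps)
  show "pos_semidef (?N ** W2 ** ?N\<^sup>T)"
    by (intro pos_semidef_congruence pos_def_imp_semidef W2)
qed

lemma pos_semidef_trace_congruence:
  "pos_semidef S \<Longrightarrow> 0 \<le> trace (H ** S ** H\<^sup>T)" for H :: "real^'a^'b"
  by (intro pos_semidef_trace pos_semidef_congruence)

lemma L_OE_ge:
  assumes "hurwitz AK"
  shows "trace (G ** Ps ** G\<^sup>T) \<le> L_OE A C G W1 W2 (AK, B, CK)"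
proof -
  obtain R Y where cov: "cov (AK, B, CK) R Y"
    using cov_exists[OF assms] by metis
  let ?H = "block_row G (- CK)"
  have "block_mat X R (R\<^sup>T) Y = block_mat Ps 0 0 0 + block_mat (X - Ps) R (R\<^sup>T) Y"
    by (simp add: block_mat_add)
  then have "L_OE A C G W1 W2 (AK, B, CK)
      = trace (?H ** block_mat Ps 0 0 0 ** ?H\<^sup>T) + trace (?H ** block_mat (X - Ps) R (R\<^sup>T) Y ** ?H\<^sup>T)"
    by (simp add: L_OE_def Sigma_cl_cov[OF assms cov] matmul.add_left matmul.add_right trace_add)
  moreover have "?H ** block_mat Ps 0 0 0 ** ?H\<^sup>T = G ** Ps ** G\<^sup>T"
    by (simp add: block_row_mult_block_mat block_row_mult_transpose matmul.zero_left matmul.zero_right)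
  ultimately show ?thesis
    using pos_semidef_trace_congruence[OF covariance_ge_Ps[OF assms cov], of ?H] by simp
qed

lemma pos_def_Y:
  assumes "hurwitz AK" "cov (AK, B, CK) R Y" "invertible R"
  shows "pos_def Y"
proof (rule pos_semidef_ker)
  note block = pos_semidef_block_lower[OF covariance_ge_Ps[OF assms(1,2)]]
  show "pos_semidef Y"
    by (rule block(1))
  show "invertible Y"
    using assms(3) block(2) unfolding invertible_iff_ker by blast
qed

lemma cov_Kalman: "cov (A - Ls ** C, Ls, G) (X - Ps) (X - Ps)"
proof -
  have "A ** (X - Ps) + (X - Ps) ** A\<^sup>T + Ps ** C\<^sup>T ** V2 ** C ** Ps
      = (A ** X + X ** A\<^sup>T + W1) - ric Ps"
    by (simp add: ric_def mat_ring)
  also have "\<dots> = 0"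
    by (simp only: X P_star diff_self)
  finally show ?thesis
    by (simp add: L_star_def mat_ring sym_Ps sym_X sym_V2 W2_inv' algebra_simps)
qed

lemma Kalman_informative:
  assumes "controllable (A - Ls ** C) Ls"
  shows "invertible (X - Ps)"
  unfolding invertible_iff_ker
proof (intro allI impI)
  fix v assume v: "(X - Ps) *v v = 0"
  let ?Z = "X - Ps"
  have symZ: "?Z\<^sup>T = ?Z"
    by (simp add: transpose_diff sym_X sym_Ps)
  have eq: "A ** ?Z + ?Z ** A\<^sup>T + Ls ** W2 ** Ls\<^sup>T = 0"
    using cov_Kalman by (simp add: mat_ring L_star_W2 algebra_simps)
  have ker: "Ls\<^sup>T *v u = 0 \<and> ?Z *v (A\<^sup>T *v u) = 0" if u: "?Z *v u = 0" for u
  proof -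
    have *: "?Z *v (A\<^sup>T *v u) + Ls *v (W2 *v (Ls\<^sup>T *v u)) = 0"
      using arg_cong[OF eq, of "\<lambda>M. M *v u"]
      by (simp add: matrix_vector_mult_add_rdistrib matrix_vector_mul_assoc [symmetric] u)
    have "u \<bullet> (?Z *v (A\<^sup>T *v u)) = 0"
      by (subst inner_transpose) (simp add: symZ u)
    then have "(Ls\<^sup>T *v u) \<bullet> (W2 *v (Ls\<^sup>T *v u)) = 0"
      using arg_cong[OF *, of "\<lambda>x. u \<bullet> x"] inner_transpose[of u Ls] by (simp add: inner_add_right)
    then have "Ls\<^sup>T *v u = 0"
      using W2 by (metis pos_def_def less_irrefl)
    with * show ?thesis
      by simp
  qed
  have "?Z *v (((*v) ((A - Ls ** C)\<^sup>T) ^^ j) v) = 0" for j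
  proof (induction j)
    case (Suc j)
    then show ?case
      using ker[OF Suc]
      by (simp add: transpose_simps matrix_vector_mult_diff_rdistrib matrix_vector_mul_assoc [symmetric])
  qed (simp add: v)
  then show "v = 0"
    using ker by (intro controllable_trivial_kernel[OF assms]) blast
qed

end

section \<open>Similarity\<close>

lemma matrix_inv_mat_1: "matrix_inv (mat 1 :: real^'n^'n) = mat 1"
  using matrix_inv_left[of "mat 1 :: real^'n^'n"] by (simp add: invertible_def exI[of _ "mat 1"])

lemma Sim_mat_1: "Sim (mat 1) K = K"
  by (cases K) (simp add: matrix_inv_mat_1)

lemma matrix_inv_unique:
  fixes M N :: "real^'n^'n"
  assumes "M ** N = mat 1"
  shows "matrix_inv M = N"
proof -
  have "invertible M"
    using assms matrix_left_right_inverse unfolding invertible_def by blast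
  then have "matrix_inv M = matrix_inv M ** (M ** N)"
    by (simp add: assms)
  then show ?thesis
    by (simp add: matrix_mul_assoc matrix_inv_left \<open>invertible M\<close>)
qed

lemma Sim_Sim:
  fixes S T :: "real^'n^'n"
  assumes "invertible S" "invertible T"
  shows "Sim S (Sim T K) = Sim (S ** T) K"
proof -
  have "(S ** T) ** (matrix_inv T ** matrix_inv S) = S ** (T ** matrix_inv T) ** matrix_inv S"
    by (simp add: matrix_mul_assoc)
  then have "matrix_inv (S ** T) = matrix_inv T ** matrix_inv S"
    using assms by (intro matrix_inv_unique) (simp add: matrix_inv_right)
  then show ?thesis
    by (cases K) (simp add: matrix_mul_assoc)
qed

lemma Sim_inverse:
  assumes "invertible S"
  shows "Sim S (Sim (matrix_inv S) K) = K" "Sim (matrix_inv S) (Sim S K) = K"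
  using assms by (simp_all add: Sim_Sim invertible_matrix_inv matrix_inv_left matrix_inv_right Sim_mat_1)

lemma Sim_linear: "Sim S (K + t *\<^sub>R h) = Sim S K + t *\<^sub>R Sim S h"
  by (cases K; cases h) (simp add: mat_ring)

section \<open>A path to the Kalman filter\<close>

context kalman
begin

lemma gain_form:
  assumes R: "invertible R"
  shows "A ** R + X ** C\<^sup>T ** B\<^sup>T + R ** M\<^sup>T = 0 \<longleftrightarrow>
    M = - (matrix_inv R ** A ** R)\<^sup>T - B ** (C ** X ** (matrix_inv R)\<^sup>T)"
    (is "?E = 0 \<longleftrightarrow> M = ?M")
proof -
  note [simp] = matrix_inv_left[OF R] matrix_inv_right[OF R]
  have "matrix_inv R ** ?E = (M - ?M)\<^sup>T"
    by (simp add: mat_ring sym_X)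
  moreover have "R ** (matrix_inv R ** ?E) = ?E"
    by (simp only: matrix_mul_assoc matrix_inv_right[OF R] matrix_mul_lid)
  ultimately have "?E = 0 \<longleftrightarrow> (M - ?M)\<^sup>T = 0"
    by (metis matmul.zero_right)
  also have "\<dots> \<longleftrightarrow> M - ?M = 0"
    by (metis transpose_transpose transpose_zero)
  finally show ?thesis
    by simp
qed

text \<open>
  Multiplying the Lyapunov inequality by \<open>Q\<close> and substituting \<open>N = Q B\<close> makes it affine in \<open>(Q, N)\<close>.
\<close>

lemma stabilizing_gains_path:
  fixes F :: "real^'n^'n" and H :: "real^'n^'m"
  assumes "hurwitz (F - B0 ** H)" "hurwitz (F - B1 ** H)"
  obtains B where "continuous_on {0..1} B" "B 0 = B0" "B (1 :: real) = B1"
    "\<And>t. t \<in> {0..1} \<Longrightarrow> hurwitz (F - B t ** H)"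
proof -
  have cert: "\<exists>Q. pos_def Q \<and> (F - B ** H)\<^sup>T ** Q + Q ** (F - B ** H) + mat 1 = 0"
    if "hurwitz (F - B ** H)" for B
  proof -
    have h: "hurwitz ((F - B ** H)\<^sup>T)"
      using that by simp
    obtain Q where Q: "(F - B ** H)\<^sup>T ** Q + Q ** ((F - B ** H)\<^sup>T)\<^sup>T + mat 1 = 0"
      using lyapunov_exists[OF h] by blast
    then show ?thesis
      using lyapunov_pos_def[OF h Q pos_def_mat_1] by auto
  qed
  obtain Q0 Q1 where Q0: "pos_def Q0" "(F - B0 ** H)\<^sup>T ** Q0 + Q0 ** (F - B0 ** H) + mat 1 = 0"
    and Q1: "pos_def Q1" "(F - B1 ** H)\<^sup>T ** Q1 + Q1 ** (F - B1 ** H) + mat 1 = 0"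
    using cert assms by metis
  have sym: "Q0\<^sup>T = Q0" "Q1\<^sup>T = Q1"
    using Q0 Q1 by (simp_all add: pos_def_def)
  define Q where "Q t = (1 - t) *\<^sub>R Q0 + t *\<^sub>R Q1" for t
  define N where "N t = (1 - t) *\<^sub>R (Q0 ** B0) + t *\<^sub>R (Q1 ** B1)" for t
  define B where "B t = matrix_inv (Q t) ** N t" for t
  have Q: "pos_def (Q t)" if "t \<in> {0..1}" for t
  proof (cases "t = 0")
    case True
    then show ?thesis by (simp add: Q_def Q0)
  next
    case False
    then have "pos_def (t *\<^sub>R Q1 + (1 - t) *\<^sub>R Q0)"
      using that by (intro pos_def_add pos_def_scaleR pos_semidef_scaleR pos_def_imp_semidef Q0 Q1) auto
    then show ?thesis by (simp add: Q_def add.commute)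
  qed
  have QB: "Q t ** B t = N t" if "t \<in> {0..1}" for t
    by (simp add: B_def matrix_mul_assoc matrix_inv_right pos_def_invertible[OF Q[OF that]])
  show thesis
  proof
    show "continuous_on {0..1} B"
    proof (rule affine_family_continuous)
      show "linear (\<lambda>x :: real^'m^'n. Q0 ** x)" "linear (\<lambda>x :: real^'m^'n. (Q1 - Q0) ** x)"
        by (rule linearI; simp add: mat_ring)+
      have eq: "Q0 ** x + t *\<^sub>R ((Q1 - Q0) ** x) = Q t ** x" for t and x :: "real^'m^'n"
        by (simp add: Q_def mat_ring algebra_simps)
      show "Q0 ** B t + t *\<^sub>R ((Q1 - Q0) ** B t) = N t" if "t \<in> {0..1}" for t
        unfolding eq by (rule QB[OF that])
      show "inj (\<lambda>x :: real^'m^'n. Q0 ** x + t *\<^sub>R ((Q1 - Q0) ** x))" if "t \<in> {0..1}" for t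
        unfolding eq
        by (rule inj_on_inverseI[where g = "\<lambda>y. matrix_inv (Q t) ** y"])
          (simp add: matrix_mul_assoc matrix_inv_left pos_def_invertible[OF Q[OF that]])
      show "continuous_on {0..1} N"
        unfolding N_def by (intro continuous_intros)
    qed
    show "B 0 = B0" "B 1 = B1"
      by (simp_all add: B_def Q_def N_def matrix_mul_assoc matrix_inv_left pos_def_invertible Q0 Q1)
    show "hurwitz (F - B t ** H)" if t: "t \<in> {0..1}" for t
    proof -
      have symQ: "(Q t)\<^sup>T = Q t"
        by (simp add: Q_def transpose_simps sym)
      have "(F - B t ** H)\<^sup>T ** Q t = (Q t ** F - N t ** H)\<^sup>T"
        by (simp add: mat_ring symQ flip: QB[OF t])
      moreover have "Q t ** (F - B t ** H) = Q t ** F - N t ** H"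
        by (simp add: mat_ring flip: QB[OF t])
      moreover have "(Q t ** F - N t ** H)\<^sup>T + (Q t ** F - N t ** H) + mat 1
        = (1 - t) *\<^sub>R ((F - B0 ** H)\<^sup>T ** Q0 + Q0 ** (F - B0 ** H) + mat 1)
          + t *\<^sub>R ((F - B1 ** H)\<^sup>T ** Q1 + Q1 ** (F - B1 ** H) + mat 1)"
        by (simp add: Q_def N_def mat_ring sym algebra_simps)
      ultimately have "(F - B t ** H)\<^sup>T ** Q t + Q t ** ((F - B t ** H)\<^sup>T)\<^sup>T + mat 1 = 0"
        by (simp add: Q0 Q1)
      then have "hurwitz ((F - B t ** H)\<^sup>T)"
        using hurwitz_certificate pos_def_imp_semidef[OF Q[OF t]] pos_def_mat_1 by blast
      then show ?thesis by simp
    qed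
  qed
qed

lemma informative_path:
  fixes G :: "real^'n^'p"
  assumes K: "(AK, B0, C0) \<in> K_info A C W1 W2" and ctrl: "controllable (A - Ls ** C) Ls"
  shows "\<exists>g. path g \<and> path_image g \<subseteq> K_info A C W1 W2 \<and>
    pathstart g = (AK, B0, C0) \<and> pathfinish g \<in> K_opt A C G W1 W2"
proof -
  have AK: "hurwitz AK"
    using K by (simp add: K_info_def K_stab_def)
  obtain R Y where cov: "cov (AK, B0, C0) R Y"
    using cov_exists[OF AK] by metis
  have R: "invertible R"
    using K K_info_iff[OF cov AK] by simp
  let ?Z = "X - Ps"
  have Z: "invertible ?Z"
    by (rule Kalman_informative[OF ctrl])
  have symZ: "?Z\<^sup>T = ?Z"
    by (simp add: transpose_diff sym_X sym_Ps)
  define S where "S = R\<^sup>T ** matrix_inv ?Z"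
  have S: "invertible S"
    unfolding S_def by (intro invertible_mult invertible_matrix_inv Z transpose_invertible R)
  have ZS: "?Z ** S\<^sup>T = R"
  proof -
    have "?Z ** S\<^sup>T = (matrix_inv ?Z ** ?Z)\<^sup>T ** R"
      by (simp add: S_def matrix_transpose_mul symZ matrix_mul_assoc)
    then show ?thesis
      by (simp add: matrix_inv_left[OF Z])
  qed
  obtain A1 B1 C1 where K1: "Sim S (A - Ls ** C, Ls, G) = (A1, B1, C1)"
    using prod_cases3 by blast
  have cov1: "cov (A1, B1, C1) R (S ** ?Z ** S\<^sup>T)"
    using cov_Sim[OF cov_Kalman S, of G] unfolding K1 ZS .
  have A1: "hurwitz A1"
    using K1 hurwitz_similar[OF P_star(3) S] by simp
  let ?F = "- (matrix_inv R ** A ** R)\<^sup>T" and ?H = "C ** X ** (matrix_inv R)\<^sup>T"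
  have form: "AK = ?F - B0 ** ?H" "A1 = ?F - B1 ** ?H"
    by (rule gain_form[OF R, THEN iffD1], use cov cov1 in simp)+
  obtain B where B: "continuous_on {0..1} B" "B 0 = B0" "B (1 :: real) = B1"
    "\<And>t. t \<in> {0..1} \<Longrightarrow> hurwitz (?F - B t ** ?H)"
    using stabilizing_gains_path[OF AK[unfolded form(1)] A1[unfolded form(2)]] by blast
  define g where "g t = (?F - B t ** ?H, B t, (1 - t) *\<^sub>R C0 + t *\<^sub>R C1)" for t
  have "continuous_on {0..1} g"
    unfolding g_def by (intro continuous_on_Pair continuous_intros matmul.continuous_on B)
  moreover have "g t \<in> K_info A C W1 W2" if t: "t \<in> {0..1}" for t
  proof -
    have "A ** R + X ** C\<^sup>T ** (B t)\<^sup>T + R ** (?F - B t ** ?H)\<^sup>T = 0"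
      using gain_form[OF R] by blast
    moreover obtain Y' where "(?F - B t ** ?H) ** Y' + Y' ** (?F - B t ** ?H)\<^sup>T +
        (B t ** C ** R + R\<^sup>T ** C\<^sup>T ** (B t)\<^sup>T + B t ** W2 ** (B t)\<^sup>T) = 0"
      using lyapunov_exists[OF B(4)[OF t]] by blast
    ultimately have "cov (g t) R Y'"
      unfolding g_def cov.simps by blast
    then show ?thesis
      using K_info_iff[OF _ B(4)[OF t]] R unfolding g_def by blast
  qed
  moreover have "g 0 = (AK, B0, C0)" "g 1 = (A1, B1, C1)"
    by (simp_all add: g_def B form)
  moreover have "(A1, B1, C1) \<in> K_opt A C G W1 W2"
    using S unfolding K_opt_def K1 [symmetric] by blast
  ultimately show ?thesis
    unfolding path_def path_image_def pathstart_def pathfinish_def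
    by (intro exI[of _ g]) (auto simp: image_subset_iff)
qed

end

section \<open>Stationary points\<close>

lemma GDERIV_directional:
  assumes "GDERIV f x :> 0"
  shows "((\<lambda>t. f (x + t *\<^sub>R h)) has_real_derivative 0) (at 0)"
proof -
  have "((\<lambda>t. x + t *\<^sub>R h) has_derivative (\<lambda>t. t *\<^sub>R h)) (at 0)"
    by (auto intro!: derivative_eq_intros)
  moreover have "(f has_derivative (\<lambda>h. 0)) (at (x + 0 *\<^sub>R h))"
    using assms by (simp add: gderiv_def)
  ultimately have "((\<lambda>t. f (x + t *\<^sub>R h)) has_derivative (\<lambda>t. 0)) (at 0)"
    by (rule has_derivative_compose)
  then show ?thesis
    unfolding has_field_derivative_def by (rule has_derivative_eq_rhs) auto
qed

lemma hurwitz_perturbation: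
  assumes "hurwitz M"
  shows "\<exists>r>0. \<forall>t. \<bar>t\<bar> \<le> r \<longrightarrow> hurwitz (M + t *\<^sub>R E)"
proof -
  obtain Q where Q: "M ** Q + Q ** M\<^sup>T + mat 1 = 0"
    using lyapunov_exists[OF assms] by blast
  have PD: "pos_def Q"
    by (rule lyapunov_pos_def[OF assms Q pos_def_mat_1])
  let ?P = "E ** Q + Q ** E\<^sup>T"
  obtain k where k: "0 < k" "\<And>x. norm (?P *v x) \<le> k * norm x"
    using linear_bounded_pos[OF matrix_vector_mul_linear[of ?P]] by blast
  have "hurwitz (M + t *\<^sub>R E)" if t: "\<bar>t\<bar> \<le> 1 / (2 * k)" for t
  proof (rule hurwitz_certificate[OF pos_def_imp_semidef[OF PD]])
    have "(M + t *\<^sub>R E) ** Q + Q ** (M + t *\<^sub>R E)\<^sup>T + (mat 1 - t *\<^sub>R ?P) = M ** Q + Q ** M\<^sup>T + mat 1"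
      by (simp add: mat_ring algebra_simps)
    then show "(M + t *\<^sub>R E) ** Q + Q ** (M + t *\<^sub>R E)\<^sup>T + (mat 1 - t *\<^sub>R ?P) = 0"
      by (simp only: Q)
    show "pos_def (mat 1 - t *\<^sub>R ?P)"
      unfolding pos_def_def
    proof (intro conjI allI impI)
      show "(mat 1 - t *\<^sub>R ?P)\<^sup>T = mat 1 - t *\<^sub>R ?P"
        using PD by (simp add: mat_ring pos_def_def add.commute)
      fix x :: "real^'a" assume "x \<noteq> 0"
      have "\<bar>x \<bullet> (?P *v x)\<bar> \<le> norm x * (k * norm x)"
        using Cauchy_Schwarz_ineq2[of x "?P *v x"] k(2)[of x]
        by (meson order_trans mult_left_mono norm_ge_zero)
      then have "\<bar>t\<bar> * \<bar>x \<bullet> (?P *v x)\<bar> \<le> 1 / (2 * k) * (norm x * (k * norm x))"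
        using t k(1) by (intro mult_mono) auto
      also have "\<dots> = (x \<bullet> x) / 2"
        using k(1) by (simp add: dot_square_norm power2_eq_square)
      finally have "t * (x \<bullet> (?P *v x)) \<le> (x \<bullet> x) / 2"
        by (metis abs_le_D1 abs_mult)
      moreover have "0 < x \<bullet> x"
        using \<open>x \<noteq> 0\<close> by simp
      ultimately have "0 < x \<bullet> x - t * (x \<bullet> (?P *v x))"
        by linarith
      then show "0 < x \<bullet> ((mat 1 - t *\<^sub>R ?P) *v x)"
        by (simp only: matrix_vector_mult_diff_rdistrib inner_diff_right matrix_vector_mul_lid
            scaleR_matrix_vector_assoc [symmetric] inner_scaleR_right)
    qed
  qed
  then show ?thesis
    using k(1) by (intro exI[of _ "1 / (2 * k)"]) simp
qed

context kalman
begin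

abbreviation loss :: "real^'n^'p \<Rightarrow> ('n, 'm, 'p::finite) filt \<Rightarrow> real" where
  "loss G \<equiv> L_OE A C G W1 W2"

definition stationary :: "real^'n^'p \<Rightarrow> ('n, 'm, 'p::finite) filt \<Rightarrow> bool" where
  "stationary G K \<longleftrightarrow> (\<forall>h. ((\<lambda>t. loss G (K + t *\<^sub>R h)) has_real_derivative 0) (at 0))"

lemma loss_Sim:
  assumes AK: "hurwitz AK" and S: "invertible S"
  shows "loss G (Sim S (AK, B, CK)) = loss G (AK, B, CK)"
proof -
  obtain R Y where cov: "cov (AK, B, CK) R Y"
    using cov_exists[OF AK] by metis
  have "S\<^sup>T ** (matrix_inv S)\<^sup>T = mat 1"
    by (simp add: matrix_inv_left[OF S] flip: matrix_transpose_mul)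
  then have [simp]: "M ** S\<^sup>T ** (matrix_inv S)\<^sup>T = M" "N ** matrix_inv S ** S = N"
    for M :: "real^'n^'p" and N :: "real^'n^'p"
    by (simp_all add: matrix_inv_left[OF S] flip: matrix_mul_assoc)
  show ?thesis
    using L_OE_cov[OF cov AK] L_OE_cov[OF cov_Sim[OF cov S, unfolded Sim.simps] hurwitz_similar[OF AK S]]
    by (simp add: mat_ring)
qed

lemma stationary_Sim:
  fixes G :: "real^'n^'p"
  assumes st: "stationary G (AK, B, CK)" and AK: "hurwitz AK" and S: "invertible S"
  shows "stationary G (Sim S (AK, B, CK))"
  unfolding stationary_def
proof
  fix h :: "('n, 'm, 'p) filt"
  let ?K = "(AK, B, CK)"
  let ?h = "Sim (matrix_inv S) h"
  obtain E H D where h: "?h = (E, H, D)"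
    using prod_cases3 by blast
  obtain r where r: "0 < r" "\<And>t. \<bar>t\<bar> \<le> r \<Longrightarrow> hurwitz (AK + t *\<^sub>R E)"
    using hurwitz_perturbation[OF AK] by blast
  have "loss G (Sim S ?K + t *\<^sub>R h) = loss G (?K + t *\<^sub>R ?h)" if "\<bar>t\<bar> \<le> r" for t
  proof -
    have "Sim S ?K + t *\<^sub>R h = Sim S (?K + t *\<^sub>R ?h)"
      by (simp only: Sim_linear Sim_inverse[OF S])
    then show ?thesis
      using loss_Sim[OF r(2)[OF that] S] by (simp add: h)
  qed
  then have ev: "\<forall>\<^sub>F t in nhds 0. loss G (Sim S ?K + t *\<^sub>R h) = loss G (?K + t *\<^sub>R ?h)"
    using r(1) unfolding eventually_nhds_metric dist_real_def by force
  show "((\<lambda>t. loss G (Sim S ?K + t *\<^sub>R h)) has_real_derivative 0) (at 0)"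
    unfolding DERIV_cong_ev[OF refl ev refl] using st unfolding stationary_def by blast
qed

lemma stationary_output_gain:
  assumes st: "stationary G (AK, B, CK)" and AK: "hurwitz AK" and cov: "cov (AK, B, CK) R Y"
  shows "CK ** Y = G ** R"
proof -
  define D where "D = CK ** Y - G ** R"
  have symY: "Y\<^sup>T = Y"
    using pos_semidef_block_lower(1)[OF covariance_ge_Ps[OF AK cov]] by (simp add: pos_semidef_def)
  have "trace (D ** Y ** CK\<^sup>T) = trace (CK ** Y ** D\<^sup>T)"
    using trace_transpose[of "CK ** Y ** D\<^sup>T"] by (simp add: mat_ring symY)
  moreover have "loss G ((AK, B, CK) + t *\<^sub>R (0, 0, D))
      = trace (G ** X ** G\<^sup>T) - 2 * trace (G ** R ** (CK + t *\<^sub>R D)\<^sup>T)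
        + trace ((CK + t *\<^sub>R D) ** Y ** (CK + t *\<^sub>R D)\<^sup>T)" for t
    using cov L_OE_cov[of AK B "CK + t *\<^sub>R D" R Y, OF _ AK] by simp
  ultimately have "loss G ((AK, B, CK) + t *\<^sub>R (0, 0, D))
      = loss G (AK, B, CK) + 2 * t * trace ((CK ** Y - G ** R) ** D\<^sup>T) + t * t * trace (D ** Y ** D\<^sup>T)" for t
    by (simp add: L_OE_cov[OF cov AK] mat_ring trace_add trace_sub trace_scaleR) (simp add: algebra_simps)
  then have eq: "loss G ((AK, B, CK) + t *\<^sub>R (0, 0, D))
      = loss G (AK, B, CK) + 2 * t * (D \<bullet> D) + t * t * trace (D ** Y ** D\<^sup>T)" for t
    by (simp only: D_def [symmetric] trace_mul_transpose)
  have "((\<lambda>t. loss G ((AK, B, CK) + t *\<^sub>R (0, 0, D))) has_real_derivative 2 * (D \<bullet> D)) (at 0)"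
    unfolding eq by (auto intro!: derivative_eq_intros)
  moreover have "((\<lambda>t. loss G ((AK, B, CK) + t *\<^sub>R (0, 0, D))) has_real_derivative 0) (at 0)"
    using st unfolding stationary_def by blast
  ultimately have "2 * (D \<bullet> D) = 0"
    by (rule DERIV_unique)
  then show ?thesis
    by (simp add: D_def)
qed

end

lemma transpose_funpow_inner:
  fixes M :: "real^'n^'n"
  shows "(((*v) (M\<^sup>T) ^^ j) u) \<bullet> v = u \<bullet> (((*v) M ^^ j) v)"
proof (induction j arbitrary: v)
  case (Suc j)
  have "(((*v) (M\<^sup>T) ^^ Suc j) u) \<bullet> v = (((*v) (M\<^sup>T) ^^ j) u) \<bullet> (M *v v)"
    by (simp add: inner_transpose[of _ M])
  also have "\<dots> = u \<bullet> (((*v) M ^^ Suc j) v)"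
    by (simp add: Suc funpow_swap1)
  finally show ?case .
qed simp

lemma orthogonal_projection_exists:
  fixes N :: "(real^'n) set"
  assumes "subspace N"
  obtains J :: "real^'n^'n" where "J\<^sup>T = J" "\<And>x. J *v x \<in> N" "\<And>x. x \<in> N \<Longrightarrow> J *v x = x"
proof -
  obtain B where B: "pairwise orthogonal B" "\<And>x. x \<in> B \<Longrightarrow> norm x = 1" "independent B" "span B = N"
    using orthonormal_basis_subspace[OF assms] by metis
  have fin: "finite B"
    using B(3) by (rule independent_imp_finite)
  define J :: "real^'n^'n" where "J = (\<chi> i j. \<Sum>b\<in>B. b $ i * b $ j)"
  have app: "J *v x = (\<Sum>b\<in>B. (b \<bullet> x) *\<^sub>R b)" for x
  proof -
    have "(\<Sum>j\<in>UNIV. (\<Sum>b\<in>B. b $ i * b $ j) * x $ j) = (\<Sum>b\<in>B. (\<Sum>j\<in>UNIV. b $ j * x $ j) * b $ i)" for i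
      unfolding sum_distrib_right by (subst sum.swap) (simp add: mult_ac)
    then show ?thesis
      by (simp add: J_def vec_eq_iff matrix_vector_mult_def inner_vec_def)
  qed
  show thesis
  proof
    show "J\<^sup>T = J"
      by (simp add: J_def transpose_def vec_eq_iff mult.commute)
    show "J *v x \<in> N" for x
      unfolding app B(4) [symmetric] by (intro span_sum span_scale span_base)
    have fix_B: "J *v c = c" if "c \<in> B" for c
    proof -
      have "b \<bullet> c = (if b = c then 1 else 0)" if "b \<in> B" for b
        using B(1,2) \<open>c \<in> B\<close> that by (auto simp: pairwise_def orthogonal_def dot_square_norm)
      then have "J *v c = (\<Sum>b\<in>B. (if b = c then 1 else 0) *\<^sub>R b)"
        unfolding app by (intro sum.cong) auto
      also have "\<dots> = (\<Sum>b\<in>B. if b = c then b else 0)"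
        by (intro sum.cong) auto
      finally show ?thesis
        using that fin by simp
    qed
    show "J *v x = x" if "x \<in> N" for x
      using that unfolding B(4) [symmetric]
    proof (induction rule: span_induct_alt)
      case (step c b y)
      then show ?case
        by (simp add: matrix_vector_right_distrib matrix_vector_mult_scaleR fix_B)
    qed simp
  qed
qed

context kalman
begin

text \<open>
  Along the direction \<open>(- H C X Z\<^sup>-\<^sup>1, H, 0)\<close> the cross covariance \<open>\<Sigma>\<^sub>1\<^sub>2\<close> stays constant, so only
  \<open>\<Sigma>\<^sub>2\<^sub>2\<close> contributes to the derivative of the loss; it is evaluated with the adjoint \<open>\<Lambda>\<close>.
\<close>

lemma stationary_input_gain:
  fixes G :: "real^'n^'p"
  assumes st: "stationary G (AK, B, G)" and AK: "hurwitz AK" and cov: "cov (AK, B, G) Z Z"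
    and symZ: "Z\<^sup>T = Z" and Z: "invertible Z"
    and \<Lambda>: "AK\<^sup>T ** \<Lambda> + \<Lambda> ** AK + G\<^sup>T ** G = 0" "\<Lambda>\<^sup>T = \<Lambda>"
  shows "\<Lambda> ** (B ** W2 - (X - Z) ** C\<^sup>T) = 0"
proof -
  define D where "D = B ** W2 - (X - Z) ** C\<^sup>T"
  define H where "H = \<Lambda> ** D"
  define E where "E = - (H ** C ** X ** matrix_inv Z)"
  have EZ: "E ** Z = - (H ** C ** X)"
    by (simp add: E_def matmul.minus_left matrix_inv_left[OF Z] flip: matrix_mul_assoc)
  have ZE: "Z ** E\<^sup>T = - (X ** C\<^sup>T ** H\<^sup>T)"
    using arg_cong[OF EZ, of transpose] by (simp add: mat_ring symZ sym_X)
  obtain r where r: "0 < r" "\<And>t. \<bar>t\<bar> \<le> r \<Longrightarrow> hurwitz (AK + t *\<^sub>R E)"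
    using hurwitz_perturbation[OF AK] by blast
  let ?S = "{- r..r}"
  define A' where "A' t = AK + t *\<^sub>R E" for t
  define B' where "B' t = B + t *\<^sub>R H" for t
  define q where "q t = B' t ** C ** Z + Z\<^sup>T ** C\<^sup>T ** (B' t)\<^sup>T + B' t ** W2 ** (B' t)\<^sup>T" for t
  have A': "hurwitz (A' t)" if "t \<in> ?S" for t
    using that by (auto simp: A'_def intro!: r(2))
  then have "\<exists>Y. t \<in> ?S \<longrightarrow> A' t ** Y + Y ** (A' t)\<^sup>T + q t = 0" for t
    using lyapunov_exists by blast
  then obtain Y where Y: "\<And>t. t \<in> ?S \<Longrightarrow> A' t ** Y t + Y t ** (A' t)\<^sup>T + q t = 0"
    by metis
  have first: "A ** Z + X ** C\<^sup>T ** (B' t)\<^sup>T + Z ** (A' t)\<^sup>T = 0" for t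
  proof -
    have "A ** Z + X ** C\<^sup>T ** (B' t)\<^sup>T + Z ** (A' t)\<^sup>T
        = (A ** Z + X ** C\<^sup>T ** B\<^sup>T + Z ** AK\<^sup>T) + t *\<^sub>R (X ** C\<^sup>T ** H\<^sup>T + Z ** E\<^sup>T)"
      by (simp add: A'_def B'_def mat_ring algebra_simps)
    moreover have "A ** Z + X ** C\<^sup>T ** B\<^sup>T + Z ** AK\<^sup>T = 0"
      using cov by simp
    ultimately show ?thesis
      by (simp only: ZE) simp
  qed
  have cov': "cov (A' t, B' t, G) Z (Y t)" if "t \<in> ?S" for t
    using first[of t] Y[OF that] unfolding q_def by simp
  have Y0: "Y 0 = Z"
  proof (rule cov_unique(2)[OF AK _ cov])
    show "cov (AK, B, G) Z (Y 0)"
      using cov'[of 0] r(1) by (simp add: A'_def B'_def)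
  qed
  have UV: "(AK ** x + x ** AK\<^sup>T) + t *\<^sub>R (E ** x + x ** E\<^sup>T) = A' t ** x + x ** (A' t)\<^sup>T" for t x
    by (simp add: A'_def mat_ring algebra_simps)
  have contB: "continuous_on ?S B'"
    unfolding B'_def by (intro continuous_intros)
  have linT: "bounded_linear (transpose :: real^'m^'n \<Rightarrow> _)"
    by (intro linear_conv_bounded_linear[THEN iffD1] linearI) (simp_all add: transpose_add transpose_scalar)
  have "continuous_on ?S Y"
  proof (rule affine_family_continuous)
    show "linear (\<lambda>x. AK ** x + x ** AK\<^sup>T)" "linear (\<lambda>x. E ** x + x ** E\<^sup>T)"
      by (rule linear_sylvester)+
    show "inj (\<lambda>x. (AK ** x + x ** AK\<^sup>T) + t *\<^sub>R (E ** x + x ** E\<^sup>T))" if "t \<in> ?S" for t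
      unfolding UV by (rule lyapunov_inj[OF A'[OF that]])
    show "(AK ** Y t + Y t ** AK\<^sup>T) + t *\<^sub>R (E ** Y t + Y t ** E\<^sup>T) = - q t" if "t \<in> ?S" for t
      unfolding UV using Y[OF that] by (simp add: eq_neg_iff_add_eq_0)
    show "continuous_on ?S (\<lambda>t. - q t)"
      unfolding q_def
      by (intro continuous_intros matmul.continuous_on contB bounded_linear.continuous_on[OF linT])
  qed
  then have limY: "(Y \<longlongrightarrow> Z) (at 0)"
    using r(1) Y0 continuous_on_interior[of ?S Y 0] by (simp add: isCont_def)
  define rate where "rate t = E ** Y t + Y t ** E\<^sup>T + H ** C ** Z + Z ** C\<^sup>T ** H\<^sup>T
    + H ** W2 ** B\<^sup>T + B ** W2 ** H\<^sup>T + t *\<^sub>R (H ** W2 ** H\<^sup>T)" for t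
  let ?f = "\<lambda>t. loss G ((AK, B, G) + t *\<^sub>R (E, H, 0))"
  have quotient: "(?f t - ?f 0) / t = trace (\<Lambda> ** rate t)" if t: "t \<in> ?S" "t \<noteq> 0" for t
  proof -
    let ?\<Delta> = "Y t - Z"
    have "AK ** ?\<Delta> + ?\<Delta> ** AK\<^sup>T + t *\<^sub>R rate t
        = (A' t ** Y t + Y t ** (A' t)\<^sup>T + q t)
          - (AK ** Z + Z ** AK\<^sup>T + (B ** C ** Z + Z\<^sup>T ** C\<^sup>T ** B\<^sup>T + B ** W2 ** B\<^sup>T))"
      by (simp add: A'_def B'_def q_def rate_def mat_ring symZ algebra_simps)
    also have "\<dots> = 0"
      using Y[OF t(1)] cov by simp
    finally have \<Delta>: "AK ** ?\<Delta> + ?\<Delta> ** AK\<^sup>T = - (t *\<^sub>R rate t)"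
      by (simp add: eq_neg_iff_add_eq_0)
    have "loss G (AK, B, G) = ?f 0"
      by simp
    then have "?f t - ?f 0 = trace (G ** Y t ** G\<^sup>T) - trace (G ** Z ** G\<^sup>T)"
      using L_OE_cov[OF cov' A', OF t(1) t(1), of G] L_OE_cov[OF cov AK, of G]
      by (simp add: A'_def B'_def)
    also have "\<dots> = trace (G ** (?\<Delta> ** G\<^sup>T))"
      by (simp add: mat_ring trace_sub)
    also have "\<dots> = trace (?\<Delta> ** (G\<^sup>T ** G))"
      by (subst trace_mul_sym) (simp add: matrix_mul_assoc)
    also have "G\<^sup>T ** G = - (AK\<^sup>T ** \<Lambda> + \<Lambda> ** AK)"
      using \<Lambda>(1) by (metis add.commute eq_neg_iff_add_eq_0)
    also have "trace (?\<Delta> ** - (AK\<^sup>T ** \<Lambda> + \<Lambda> ** AK))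
        = - trace ((?\<Delta> ** AK\<^sup>T) ** \<Lambda>) - trace ((?\<Delta> ** \<Lambda>) ** AK)"
      by (simp only: matmul.minus_right matmul.add_right trace_uminus trace_add matrix_mul_assoc
          minus_add_distrib diff_conv_add_uminus)
    also have "trace ((?\<Delta> ** \<Lambda>) ** AK) = trace ((AK ** ?\<Delta>) ** \<Lambda>)"
      by (subst trace_mul_sym) (simp only: matrix_mul_assoc)
    also have "- trace ((?\<Delta> ** AK\<^sup>T) ** \<Lambda>) - trace ((AK ** ?\<Delta>) ** \<Lambda>)
        = - trace ((AK ** ?\<Delta> + ?\<Delta> ** AK\<^sup>T) ** \<Lambda>)"
      by (simp add: matmul.add_left trace_add)
    also have "\<dots> = t * trace (rate t ** \<Lambda>)"
      unfolding \<Delta> by (simp add: mat_ring trace_uminus trace_scaleR)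
    also have "trace (rate t ** \<Lambda>) = trace (\<Lambda> ** rate t)"
      by (rule trace_mul_sym)
    finally show ?thesis
      using t(2) by simp
  qed
  have limt: "((\<lambda>t. t) \<longlongrightarrow> 0) (at (0 :: real))"
    by (rule tendsto_ident_at)
  let ?rate0 = "E ** Z + Z ** E\<^sup>T + H ** C ** Z + Z ** C\<^sup>T ** H\<^sup>T
    + H ** W2 ** B\<^sup>T + B ** W2 ** H\<^sup>T + 0 *\<^sub>R (H ** W2 ** H\<^sup>T)"
  have "(rate \<longlongrightarrow> ?rate0) (at 0)"
    unfolding rate_def
    by (intro tendsto_add tendsto_scaleR matmul.tendsto tendsto_const limY limt)
  then have lim: "((\<lambda>t. trace (\<Lambda> ** rate t)) \<longlongrightarrow> trace (\<Lambda> ** ?rate0)) (at 0)"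
    by (intro bounded_linear.tendsto[OF bounded_linear_trace] matmul.tendsto tendsto_const)
  have quot0: "((\<lambda>t. (?f t - ?f 0) / t) \<longlongrightarrow> 0) (at 0)"
  proof -
    have "(?f has_real_derivative 0) (at 0)"
      using st unfolding stationary_def by blast
    then show ?thesis
      by (simp add: DERIV_def)
  qed
  have ev: "\<forall>\<^sub>F t in at 0. (?f t - ?f 0) / t = trace (\<Lambda> ** rate t)"
    unfolding eventually_at dist_real_def
    by (intro exI[of _ r] conjI ballI impI r(1) quotient) auto
  have "((\<lambda>t. trace (\<Lambda> ** rate t)) \<longlongrightarrow> 0) (at 0)"
    by (rule Lim_transform_eventually[OF quot0 ev])
  then have "trace (\<Lambda> ** ?rate0) = 0"
    by (rule LIM_unique[OF lim])
  moreover have "?rate0 = H ** D\<^sup>T + D ** H\<^sup>T"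
    unfolding EZ ZE by (simp add: D_def mat_ring sym_W2 sym_X symZ algebra_simps)
  ultimately have "trace (\<Lambda> ** (H ** D\<^sup>T + D ** H\<^sup>T)) = 0"
    by (simp only:)
  moreover have "trace (\<Lambda> ** (H ** D\<^sup>T)) = trace (\<Lambda> ** (D ** H\<^sup>T))"
  proof -
    have "trace (\<Lambda> ** (H ** D\<^sup>T)) = trace ((\<Lambda> ** (H ** D\<^sup>T))\<^sup>T)"
      by (rule trace_transpose[symmetric])
    also have "\<dots> = trace ((D ** H\<^sup>T) ** \<Lambda>)"
      by (simp add: matrix_transpose_mul \<Lambda>(2))
    also have "\<dots> = trace (\<Lambda> ** (D ** H\<^sup>T))"
      by (rule trace_mul_sym)
    finally show ?thesis .
  qed
  ultimately have "trace (\<Lambda> ** (D ** H\<^sup>T)) = 0"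
    by (simp add: matmul.add_right trace_add)
  then have "H \<bullet> H = 0"
    by (simp add: H_def matrix_mul_assoc flip: trace_mul_transpose)
  then show ?thesis
    by (simp add: H_def D_def)
qed

text \<open>
  The situation after the change of coordinates that makes \<open>\<Sigma>\<^sub>1\<^sub>2 = \<Sigma>\<^sub>2\<^sub>2 = Z\<close>. Then \<open>P = X - Z\<close> is the
  error covariance of the observer with gain \<open>B\<close>, and \<open>D\<close> its deviation from the Riccati equation.
\<close>

lemma balanced_identities:
  assumes cov: "cov (AK, B, CK) Z Z" and symZ: "Z\<^sup>T = Z" and Z: "invertible Z"
    and P: "P = X - Z" and D: "D = B ** W2 - P ** C\<^sup>T"
  shows "(A - B ** C) ** P + P ** (A - B ** C)\<^sup>T + (W1 + B ** W2 ** B\<^sup>T) = 0"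
    and "ric P = - (D ** V2 ** D\<^sup>T)"
    and "AK = A - B ** C - D ** B\<^sup>T ** matrix_inv Z"
proof -
  have symP: "P\<^sup>T = P"
    by (simp add: P transpose_diff sym_X symZ)
  have c1: "A ** Z + X ** C\<^sup>T ** B\<^sup>T + Z ** AK\<^sup>T = 0"
    and c2: "AK ** Z + Z ** AK\<^sup>T + (B ** C ** Z + Z ** C\<^sup>T ** B\<^sup>T + B ** W2 ** B\<^sup>T) = 0"
    using cov symZ by simp_all
  have "(A ** Z + X ** C\<^sup>T ** B\<^sup>T + Z ** AK\<^sup>T)\<^sup>T = 0"
    by (simp add: c1)
  then have c3: "Z ** A\<^sup>T + B ** C ** X + AK ** Z = 0"
    by (simp add: mat_ring sym_X symZ)
  have "(A - B ** C) ** P + P ** (A - B ** C)\<^sup>T + (W1 + B ** W2 ** B\<^sup>T)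
      = (AK ** Z + Z ** AK\<^sup>T + (B ** C ** Z + Z ** C\<^sup>T ** B\<^sup>T + B ** W2 ** B\<^sup>T))
        - (A ** Z + X ** C\<^sup>T ** B\<^sup>T + Z ** AK\<^sup>T) - (Z ** A\<^sup>T + B ** C ** X + AK ** Z)
        + (A ** X + X ** A\<^sup>T + W1)"
    by (simp add: P mat_ring algebra_simps)
  then show obs: "(A - B ** C) ** P + P ** (A - B ** C)\<^sup>T + (W1 + B ** W2 ** B\<^sup>T) = 0"
    by (simp add: c1 c2 c3 X)
  let ?L = "P ** C\<^sup>T ** V2"
  have DV: "B - ?L = D ** V2"
    by (simp add: D mat_ring W2_inv')
  have "ric P + (D ** V2) ** W2 ** (D ** V2)\<^sup>T = 0"
    using gain_identity[OF symP refl, of B] obs by (simp add: DV)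
  then show "ric P = - (D ** V2 ** D\<^sup>T)"
    by (simp add: mat_ring W2_inv' sym_V2 eq_neg_iff_add_eq_0)
  have "AK ** Z - ((A - B ** C) ** Z - D ** B\<^sup>T)
      = (Z ** A\<^sup>T + B ** C ** X + AK ** Z) - (A ** X + X ** A\<^sup>T + W1)
        + ((A - B ** C) ** P + P ** (A - B ** C)\<^sup>T + (W1 + B ** W2 ** B\<^sup>T))"
    by (simp add: P D mat_ring algebra_simps)
  then have "AK ** Z = (A - B ** C) ** Z - D ** B\<^sup>T"
    by (simp add: c3 X obs)
  then have "AK ** Z ** matrix_inv Z = ((A - B ** C) ** Z - D ** B\<^sup>T) ** matrix_inv Z"
    by simp
  then show "AK = A - B ** C - D ** B\<^sup>T ** matrix_inv Z"
    by (simp add: matmul.diff_left matrix_inv_right[OF Z] flip: matrix_mul_assoc)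
qed

lemma adjoint_kernel:
  fixes G :: "real^'n^'p"
  assumes \<Lambda>: "AK\<^sup>T ** \<Lambda> + \<Lambda> ** AK + G\<^sup>T ** G = 0" "\<Lambda>\<^sup>T = \<Lambda>" and u: "\<Lambda> *v u = 0"
  shows "G *v u = 0" "\<Lambda> *v (AK *v u) = 0"
proof -
  have eq: "\<Lambda> *v (AK *v u) + G\<^sup>T *v (G *v u) = 0"
    using arg_cong[OF \<Lambda>(1), of "\<lambda>M. M *v u"]
    by (simp add: matrix_vector_mult_add_rdistrib matrix_vector_mul_assoc [symmetric] u)
  moreover have "u \<bullet> (\<Lambda> *v (AK *v u)) = 0"
    by (subst inner_transpose) (simp add: \<Lambda>(2) u)
  ultimately have "u \<bullet> (G\<^sup>T *v (G *v u)) = 0"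
    by (metis add_0 inner_add_right inner_zero_right)
  then show G: "G *v u = 0"
    by (simp add: inner_transpose[of u])
  show "\<Lambda> *v (AK *v u) = 0"
    using eq by (simp add: G)
qed

lemma balanced_optimal:
  fixes G :: "real^'n^'p"
  assumes AK: "hurwitz AK" and cov: "cov (AK, B, G) Z Z" and symZ: "Z\<^sup>T = Z" and Z: "invertible Z"
    and \<Lambda>: "AK\<^sup>T ** \<Lambda> + \<Lambda> ** AK + G\<^sup>T ** G = 0" "\<Lambda>\<^sup>T = \<Lambda>"
    and \<Lambda>D: "\<Lambda> ** (B ** W2 - (X - Z) ** C\<^sup>T) = 0"
  shows "loss G (AK, B, G) = trace (G ** Ps ** G\<^sup>T)"
proof -
  define P where "P = X - Z"
  define D where "D = B ** W2 - P ** C\<^sup>T"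
  note id = balanced_identities[OF cov symZ Z P_def D_def]
  have symP: "P\<^sup>T = P"
    by (simp add: P_def transpose_diff sym_X symZ)
  define E where "E = P - Ps"
  have symE: "E\<^sup>T = E"
    by (simp add: E_def transpose_diff symP sym_Ps)
  define N where "N = - (V2 ** D\<^sup>T) - (V2 ** C + B\<^sup>T ** matrix_inv Z) ** E"
  have LP: "P ** C\<^sup>T ** V2 = B - D ** V2"
    by (simp add: D_def mat_ring W2_inv')
  have "AK ** E + E ** (A - Ls ** C)\<^sup>T = D ** N"
  proof -
    have "(A - P ** C\<^sup>T ** V2 ** C) ** E + E ** (A - Ls ** C)\<^sup>T = ric P - ric Ps"
      by (simp add: E_def ric_def L_star_def mat_ring symP sym_Ps sym_V2)
    also have "\<dots> = - (D ** V2 ** D\<^sup>T)"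
      by (simp add: id P_star)
    finally have "(A - (B - D ** V2) ** C) ** E + E ** (A - Ls ** C)\<^sup>T + D ** V2 ** D\<^sup>T = 0"
      unfolding LP by simp
    moreover have "AK ** E + E ** (A - Ls ** C)\<^sup>T - D ** N
        = (A - (B - D ** V2) ** C) ** E + E ** (A - Ls ** C)\<^sup>T + D ** V2 ** D\<^sup>T"
      by (subst id(3)) (simp add: N_def mat_ring algebra_simps)
    ultimately show ?thesis
      by simp
  qed
  from arg_cong[OF this, of transpose]
  have eqT: "E ** AK\<^sup>T + (A - Ls ** C) ** E = N\<^sup>T ** D\<^sup>T"
    by (simp add: transpose_add matrix_transpose_mul symE)
  have step: "E *v (AK\<^sup>T *v u) = (- (A - Ls ** C)) *v (E *v u) + N\<^sup>T *v (D\<^sup>T *v u)" for u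
    unfolding matrix_vector_mul_assoc eqT [symmetric]
    by (simp add: matrix_vector_mult_add_rdistrib matrix_vector_uminus matmul.minus_left
        del: minus_diff_eq)
  have GD: "G *v (((*v) AK ^^ j) (D *v x)) = 0" for j x
  proof -
    have "\<Lambda> *v (((*v) AK ^^ j) (D *v x)) = 0"
    proof (induction j)
      case 0
      then show ?case
        using \<Lambda>D by (simp add: D_def P_def matrix_vector_mul_assoc)
    next
      case (Suc j)
      then show ?case
        using adjoint_kernel(2)[OF \<Lambda>] by simp
    qed
    then show ?thesis
      by (rule adjoint_kernel(1)[OF \<Lambda>])
  qed
  have DG: "D\<^sup>T *v (((*v) (AK\<^sup>T) ^^ j) (G\<^sup>T *v w)) = 0" for j w
  proof -
    have "y \<bullet> (D\<^sup>T *v (((*v) (AK\<^sup>T) ^^ j) (G\<^sup>T *v w))) = 0" for y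
    proof -
      have "y \<bullet> (D\<^sup>T *v (((*v) (AK\<^sup>T) ^^ j) (G\<^sup>T *v w))) = (((*v) (AK\<^sup>T) ^^ j) (G\<^sup>T *v w)) \<bullet> (D *v y)"
        by (simp add: inner_transpose[of y] inner_commute)
      also have "\<dots> = w \<bullet> (G *v (((*v) AK ^^ j) (D *v y)))"
        unfolding transpose_funpow_inner by (simp add: inner_transpose[of w])
      finally show ?thesis
        by (simp add: GD)
    qed
    then show ?thesis
      by (metis inner_eq_zero_iff)
  qed
  have "E *v (G\<^sup>T *v w) = 0" for w
  proof (rule hurwitz_intertwine)
    show "hurwitz (AK\<^sup>T)" "hurwitz (A - Ls ** C)"
      using AK P_star by simp_all
    show "E *v ((*v) (AK\<^sup>T) ^^ j) (G\<^sup>T *v w) = ((*v) (- (A - Ls ** C)) ^^ j) (E *v (G\<^sup>T *v w))" for j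
      by (induction j) (simp_all add: step DG)
  qed
  then have "E ** G\<^sup>T = 0"
    by (simp add: matrix_eq_0_iff flip: matrix_vector_mul_assoc)
  then have EG: "G ** E ** G\<^sup>T = 0"
    by (simp add: matmul.zero_right flip: matrix_mul_assoc)
  have "X = Z + Ps + E"
    by (simp add: E_def P_def)
  then have "G ** X ** G\<^sup>T = G ** Z ** G\<^sup>T + G ** Ps ** G\<^sup>T"
    by (simp add: mat_ring EG)
  then show ?thesis
    by (simp add: L_OE_cov[OF cov AK] trace_add)
qed

text \<open>
  Projecting the filter state orthogonally to the unobservable subspace \<open>ker \<Lambda>\<close>, and letting the
  complement decay on its own, does not change the filter output but loses controllability.
\<close>

lemma unobservable_imp_uncontrollable_optimal:
  fixes G :: "real^'n^'p"
  assumes AK: "hurwitz AK" and cov: "cov (AK, B, G) Z Y"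
    and \<Lambda>: "AK\<^sup>T ** \<Lambda> + \<Lambda> ** AK + G\<^sup>T ** G = 0" "\<Lambda>\<^sup>T = \<Lambda>" and sing: "\<not> invertible \<Lambda>"
  obtains A2 B2 where "hurwitz A2" "\<not> controllable A2 B2" "loss G (A2, B2, G) = loss G (AK, B, G)"
proof -
  have "subspace {v. \<Lambda> *v v = 0}"
    by (simp add: subspace_def matrix_vector_right_distrib matrix_vector_mult_scaleR)
  then obtain J where J: "J\<^sup>T = J" "\<And>x. \<Lambda> *v (J *v x) = 0" "\<And>x. \<Lambda> *v x = 0 \<Longrightarrow> J *v x = x"
    using orthogonal_projection_exists by (metis (mono_tags, lifting) mem_Collect_eq)
  define U where "U = mat 1 - J"
  have symU: "U\<^sup>T = U"
    by (simp add: U_def transpose_diff J)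
  have idem: "J ** J = J"
    unfolding matrix_eq by (simp add: J flip: matrix_vector_mul_assoc)
  have UJ: "U ** J = 0" and JU: "J ** U = 0"
    by (simp_all add: U_def mat_ring idem)
  have GJ: "G ** J = 0"
    unfolding matrix_eq by (simp add: adjoint_kernel(1)[OF \<Lambda> J(2)] flip: matrix_vector_mul_assoc)
  then have GU: "G ** U = G"
    by (simp add: U_def mat_ring)
  have UG: "U ** G\<^sup>T = G\<^sup>T"
    using arg_cong[OF GU, of transpose] by (simp add: matrix_transpose_mul symU)
  have "J ** (AK ** J) = AK ** J"
    unfolding matrix_eq using J(3)[OF adjoint_kernel(2)[OF \<Lambda> J(2)]]
    by (simp flip: matrix_vector_mul_assoc)
  then have "U ** AK ** J = 0"
    by (simp add: U_def mat_ring)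
  then have UAU: "U ** AK ** U = U ** AK"
    by (subst U_def) (simp add: mat_ring, simp add: U_def mat_ring)
  define A2 where "A2 = U ** AK - J"
  have A2U: "A2 ** U = U ** AK"
    by (simp add: A2_def mat_ring UAU JU)
  have A2T: "A2\<^sup>T = AK\<^sup>T ** U - J"
    by (simp add: A2_def transpose_diff matrix_transpose_mul symU J)
  have UA2T: "U ** A2\<^sup>T = AK\<^sup>T ** U"
    using arg_cong[OF A2U, of transpose] by (simp add: matrix_transpose_mul symU)
  have "hurwitz (A2\<^sup>T)"
    unfolding hurwitz_iff_real
  proof (intro allI impI)
    fix s w a b
    assume ab: "(a \<noteq> 0 \<or> b \<noteq> 0) \<and> A2\<^sup>T *v a = s *\<^sub>R a - w *\<^sub>R b \<and> A2\<^sup>T *v b = w *\<^sub>R a + s *\<^sub>R b"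
    show "s < 0"
    proof (cases "U *v a = 0 \<and> U *v b = 0")
      case True
      have "A2\<^sup>T *v x = - x" if "U *v x = 0" for x
      proof -
        have "J *v x = x"
          using that by (simp add: U_def matrix_vector_mult_diff_rdistrib)
        then show ?thesis
          using that by (simp add: A2T matrix_vector_mult_diff_rdistrib flip: matrix_vector_mul_assoc)
      qed
      with True ab have eq: "- a = s *\<^sub>R a - w *\<^sub>R b" "- b = w *\<^sub>R a + s *\<^sub>R b"
        by metis+
      have "- (a \<bullet> a) = s * (a \<bullet> a) - w * (a \<bullet> b)" "- (b \<bullet> b) = w * (a \<bullet> b) + s * (b \<bullet> b)"
        using arg_cong[OF eq(1), of "\<lambda>x. a \<bullet> x"] arg_cong[OF eq(2), of "\<lambda>x. b \<bullet> x"]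
        by (simp_all add: inner_diff_right inner_add_right inner_commute)
      then have "s * (a \<bullet> a + b \<bullet> b) = - (a \<bullet> a + b \<bullet> b)"
        by (simp add: algebra_simps)
      moreover have "0 < a \<bullet> a + b \<bullet> b"
        using ab by (metis add_nonneg_pos add_pos_nonneg inner_ge_zero inner_gt_zero_iff)
      ultimately show ?thesis
        by (metis mult_less_0_iff neg_less_0_iff_less order_less_asym)
    next
      case False
      have U: "AK\<^sup>T *v (U *v x) = U *v (A2\<^sup>T *v x)" for x
        by (simp add: matrix_vector_mul_assoc UA2T)
      have "AK\<^sup>T *v (U *v a) = s *\<^sub>R (U *v a) - w *\<^sub>R (U *v b)"
        "AK\<^sup>T *v (U *v b) = w *\<^sub>R (U *v a) + s *\<^sub>R (U *v b)"
        using ab by (simp_all add: U matrix_vector_mult_diff_distrib matrix_vector_right_distrib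
            matrix_vector_mult_scaleR)
      moreover have "hurwitz (AK\<^sup>T)"
        using AK by simp
      ultimately show ?thesis
        using False unfolding hurwitz_iff_real by blast
    qed
  qed
  then have A2: "hurwitz A2"
    by simp
  have cov2: "cov (A2, U ** B, G) (Z ** U\<^sup>T) (U ** Y ** U\<^sup>T)"
    by (rule cov_pushforward[OF cov A2U])
  have GU': "M ** U ** G\<^sup>T = M ** G\<^sup>T" for M :: "real^'n^'p"
    by (simp add: UG flip: matrix_mul_assoc)
  have "loss G (A2, U ** B, G) = loss G (AK, B, G)"
    by (simp add: L_OE_cov[OF cov2 A2] L_OE_cov[OF cov AK] symU matrix_mul_assoc GU GU')
  moreover have "\<not> controllable A2 (U ** B)"
  proof
    assume ctrl: "controllable A2 (U ** B)"
    obtain v where v: "\<Lambda> *v v = 0" "v \<noteq> 0"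
      using sing by (auto simp: invertible_iff_ker)
    have Uv: "U *v v = 0"
      using J(3)[OF v(1)] by (simp add: U_def matrix_vector_mult_diff_rdistrib)
    have "U *v (((*v) (A2\<^sup>T) ^^ j) v) = 0" for j
    proof (induction j)
      case (Suc j)
      have "U *v (A2\<^sup>T *v x) = AK\<^sup>T *v (U *v x)" for x
        by (simp add: matrix_vector_mul_assoc UA2T)
      with Suc show ?case
        by simp
    qed (simp add: Uv)
    then have "(U ** B)\<^sup>T *v (((*v) (A2\<^sup>T) ^^ j) v) = 0" for j
      by (simp add: matrix_transpose_mul symU flip: matrix_vector_mul_assoc)
    then have "v = 0"
      by (rule controllable_trivial_kernel[OF ctrl])
    with v(2) show False
      by simp
  qed
  ultimately show thesis
    using that A2 by blast
qed

lemma balanced_observable_imp_Kalman: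
  fixes G :: "real^'n^'p"
  assumes AK: "hurwitz AK" and cov: "cov (AK, B, G) Z Z" and symZ: "Z\<^sup>T = Z" and Z: "invertible Z"
    and D: "B ** W2 - (X - Z) ** C\<^sup>T = 0"
  shows "AK = A - Ls ** C" "B = Ls"
proof -
  note id = balanced_identities[OF cov symZ Z refl refl, unfolded D]
  have AK_eq: "AK = A - B ** C"
    using id(3) by (simp add: matmul.zero_left)
  have "B ** W2 ** V2 = (X - Z) ** C\<^sup>T ** V2"
    using D by simp
  then have B: "B = (X - Z) ** C\<^sup>T ** V2"
    by (simp add: W2_inv')
  have "pos_semidef (X - Z)"
    by (rule lyapunov_pos_semidef[OF AK id(1)[folded AK_eq] pos_def_imp_semidef[OF pos_def_forcing]])
  moreover have "ric (X - Z) = 0"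
    using id(2) by (simp add: matmul.zero_left)
  ultimately have "stabilizing_riccati_solution A C W1 W2 (X - Z)"
    using AK unfolding stabilizing_iff AK_eq by (simp flip: B)
  then have "Ps = X - Z"
    by (rule P_star_eq)
  then show "B = Ls"
    by (simp add: L_star_def B)
  then show "AK = A - Ls ** C"
    by (simp add: AK_eq)
qed

lemma loss_minimal_imp_optimal:
  assumes "hurwitz AK" "loss G (AK, B, CK) = trace (G ** Ps ** G\<^sup>T)"
  shows "(AK, B, CK) \<in> optimal_filters A C G W1 W2"
  using assms L_OE_ge unfolding optimal_filters_def K_stab_def by auto

theorem stationary_informative:
  fixes G :: "real^'n^'p"
  assumes K: "K \<in> K_info A C W1 W2" and grad: "GDERIV (loss G) K :> 0"
  shows "K \<in> optimal_filters A C G W1 W2 \<and>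
    ((\<forall>(AK, BK, CK) \<in> optimal_filters A C G W1 W2. controllable AK BK) \<longrightarrow> K \<in> K_opt A C G W1 W2)"
proof -
  obtain AK0 B0 C0 where K_eq: "K = (AK0, B0, C0)"
    using prod_cases3 by blast
  have AK0: "hurwitz AK0"
    using K by (simp add: K_info_def K_stab_def K_eq)
  obtain R Y where cov0: "cov (AK0, B0, C0) R Y"
    using cov_exists[OF AK0] by metis
  have R: "invertible R"
    using K K_info_iff[OF cov0 AK0] by (simp add: K_eq)
  have PD: "pos_def Y"
    by (rule pos_def_Y[OF AK0 cov0 R])
  have Y: "invertible Y"
    by (rule pos_def_invertible[OF PD])
  have symY: "Y\<^sup>T = Y" "(matrix_inv Y)\<^sup>T = matrix_inv Y"
    using PD pos_def_inverse[OF PD] by (simp_all add: pos_def_def)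
  define T where "T = R ** matrix_inv Y"
  define Z where "Z = R ** T\<^sup>T"
  have T: "invertible T"
    unfolding T_def by (intro invertible_mult invertible_matrix_inv R Y)
  have Z: "invertible Z"
    unfolding Z_def by (intro invertible_mult transpose_invertible R T)
  have Z_eq: "Z = R ** matrix_inv Y ** R\<^sup>T"
    by (simp add: Z_def T_def matrix_transpose_mul symY matrix_mul_assoc)
  then have symZ: "Z\<^sup>T = Z"
    by (simp add: matrix_transpose_mul symY matrix_mul_assoc)
  have "T ** Y ** T\<^sup>T = R ** (matrix_inv Y ** Y) ** T\<^sup>T"
    by (simp add: T_def matrix_mul_assoc)
  then have TYT: "T ** Y ** T\<^sup>T = Z"
    by (simp add: matrix_inv_left[OF Y] Z_def)
  obtain AK B CK where K1: "Sim T K = (AK, B, CK)"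
    using prod_cases3 by blast
  have AK: "hurwitz AK"
    using K1 hurwitz_similar[OF AK0 T] by (auto simp: K_eq)
  have cov1: "cov (AK, B, CK) Z Z"
    using cov_Sim[OF cov0 T] unfolding K_eq [symmetric] K1 TYT Z_def [symmetric] .
  have "stationary G K"
    unfolding stationary_def using GDERIV_directional[OF grad] by blast
  then have st: "stationary G (AK, B, CK)"
    using stationary_Sim[OF _ AK0 T, of G B0 C0] unfolding K_eq [symmetric] K1 by blast
  have "CK ** Z = G ** Z"
    by (rule stationary_output_gain[OF st AK cov1])
  then have "CK ** Z ** matrix_inv Z = G ** Z ** matrix_inv Z"
    by simp
  then have CK: "CK = G"
    by (simp add: matrix_inv_right[OF Z] flip: matrix_mul_assoc)
  note st = st[unfolded CK] and cov = cov1[unfolded CK]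
  have AKT: "hurwitz (AK\<^sup>T)"
    using AK by simp
  obtain \<Lambda> where "AK\<^sup>T ** \<Lambda> + \<Lambda> ** (AK\<^sup>T)\<^sup>T + G\<^sup>T ** G = 0"
    using lyapunov_exists[OF AKT] by blast
  moreover from this have "\<Lambda>\<^sup>T = \<Lambda>"
    by (rule lyapunov_symmetric[OF AKT]) (simp add: matrix_transpose_mul)
  ultimately have \<Lambda>: "AK\<^sup>T ** \<Lambda> + \<Lambda> ** AK + G\<^sup>T ** G = 0" "\<Lambda>\<^sup>T = \<Lambda>"
    by simp_all
  have \<Lambda>D: "\<Lambda> ** (B ** W2 - (X - Z) ** C\<^sup>T) = 0"
    by (rule stationary_input_gain[OF st AK cov symZ Z \<Lambda>])
  have val: "loss G (AK, B, G) = trace (G ** Ps ** G\<^sup>T)"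
    by (rule balanced_optimal[OF AK cov symZ Z \<Lambda> \<Lambda>D])
  have "loss G K = loss G (AK, B, G)"
    using loss_Sim[OF AK0 T, of G B0 C0] unfolding K_eq [symmetric] K1 CK by simp
  then have opt: "K \<in> optimal_filters A C G W1 W2"
    using loss_minimal_imp_optimal[OF AK0] val by (simp add: K_eq)
  have "K \<in> K_opt A C G W1 W2"
    if ctrl: "\<forall>(AK, BK, CK) \<in> optimal_filters A C G W1 W2. controllable AK BK"
  proof -
    have "invertible \<Lambda>"
    proof (rule ccontr)
      assume "\<not> invertible \<Lambda>"
      then obtain A2 B2 where "hurwitz A2" "\<not> controllable A2 B2" "loss G (A2, B2, G) = loss G (AK, B, G)"
        using unobservable_imp_uncontrollable_optimal[OF AK cov \<Lambda>] by blast
      with ctrl val show False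
        using loss_minimal_imp_optimal[of A2 G B2 G] by auto
    qed
    then have "matrix_inv \<Lambda> ** (\<Lambda> ** (B ** W2 - (X - Z) ** C\<^sup>T)) = B ** W2 - (X - Z) ** C\<^sup>T"
      by (simp only: matrix_mul_assoc matrix_inv_left matrix_mul_lid)
    then have "B ** W2 - (X - Z) ** C\<^sup>T = 0"
      by (simp only: \<Lambda>D matmul.zero_right)
    then have "AK = A - Ls ** C" "B = Ls"
      using balanced_observable_imp_Kalman[OF AK cov symZ Z] by blast+
    then have "K = Sim (matrix_inv T) (A - Ls ** C, Ls, G)"
      using Sim_inverse(2)[OF T, of K] by (simp only: K1 CK)
    then show ?thesis
      using invertible_matrix_inv[OF T] unfolding K_opt_def by blast
  qed
  with opt show ?thesis
    by blast
qed

end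

theorem theorem2:
  fixes A :: "real^'n^'n" and C :: "real^'n^'m" and G :: "real^'n^'p"
    and W1 :: "real^'n^'n" and W2 :: "real^'m^'m"
    and K :: "('n, 'm, 'p) filt"
  assumes S1: "hurwitz A"
    and S2: "observable A C"
    and S3: "pos_def W1" "pos_def W2"
    and S4: "\<forall>(AK, BK, CK) \<in> K_opt A C G W1 W2. controllable AK BK"
    and K: "K \<in> K_info A C W1 W2"
  shows "(\<exists>g. path g \<and> path_image g \<subseteq> K_info A C W1 W2 \<and>
            pathstart g = K \<and> pathfinish g \<in> K_opt A C G W1 W2)
       \<and> (GDERIV (L_OE A C G W1 W2) K :> 0 \<longrightarrow>
            K \<in> optimal_filters A C G W1 W2 \<and>
            ((\<forall>(AK, BK, CK) \<in> optimal_filters A C G W1 W2. controllable AK BK) \<longrightarrow>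
              K \<in> K_opt A C G W1 W2))"
proof -
  interpret kalman A C W1 W2
    using S1 S3 by unfold_locales
  have "Sim (mat 1) (A - Ls ** C, Ls, G) \<in> K_opt A C G W1 W2"
    unfolding K_opt_def by (force simp: invertible_def intro: exI[of _ "mat 1"])
  then have "controllable (A - Ls ** C) Ls"
    using S4 unfolding Sim_mat_1 by blast
  then show ?thesis
    using informative_path K stationary_informative[OF K] by (cases K) blast
qed

end
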